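(* The connection matrix $\widehat\Xi$ of $\nabla_Y$ with respect to the frame ${}^t(\widehat\varphi_1,\dots,\widehat\varphi_4)$, i.e. the matrix of $1$-forms with $\nabla_Y\,{}^t(\widehat\varphi_1,\dots,\widehat\varphi_4)=\widehat\Xi\wedge{}^t(\widehat\varphi_1,\dots,\widehat\varphi_4)$, is $$\widehat\Xi=\widehat\Xi^1\frac{dy_1}{y_1}+\widehat\Xi^2\frac{dy_2}{y_2}+I_{3,1}\widehat\Xi^2I_{3,1}^{-1}\frac{dy_1}{y_1-1}+I_{3,1}\widehat\Xi^1I_{3,1}^{-1}\frac{dy_2}{y_2-1}+\widehat\Xi^3\frac{dy_1+dy_2}{y_1+y_2-1},$$ where $$\widehat\Xi^1=\begin{pmatrix} 0&-\lambda_4&0&0\\ 0&-\lambda_1-\lambda_3&0&0\\ \frac{-\lambda_{123}}{2}&\frac{-\lambda_2+\lambda_4}{2}&\frac{-\lambda_1+\lambda_4}{2}&\frac{-\lambda_3}{2}\\ \frac{(\lambda_{134}^--\lambda_3)\lambda_{123}}{2\lambda_3}&\lambda_4+\frac{(\lambda_2+\lambda_4)(\lambda_1+\lambda_4)}{2\lambda_3}&\frac{(\lambda_1-\lambda_4)(\lambda_{134}^--\lambda_3)}{2\lambda_3}&\frac{\lambda_{134}^--\lambda_3}{2} \end{pmatrix},$$ $$\widehat\Xi^2=\begin{pmatrix} 0&0&-\lambda_4&0\\ \frac{-\lambda_{123}}{2}&\frac{-\lambda_2+\lambda_4}{2}&\frac{-\lambda_1+\lambda_4}{2}&\frac{-\lambda_3}{2}\\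 0&0&-\lambda_3-\lambda_2&0\\ \frac{(\lambda_{234}^--\lambda_3)\lambda_{123}}{2\lambda_3}&\frac{(\lambda_2-\lambda_4)(\lambda_{234}^--\lambda_3)}{2\lambda_3}&\lambda_4+\frac{(\lambda_2+\lambda_4)(\lambda_1+\lambda_4)}{2\lambda_3}&\frac{\lambda_{234}^--\lambda_3}{2} \end{pmatrix},$$ $$\widehat\Xi^3=\mathrm{diag}(0,0,0,2(\lambda_3+\lambda_4)),\qquad I_{3,1}=\mathrm{diag}(1,1,1,-1).$$ The connection matrix $\widehat\Xi$ satisfies $d_y\widehat\Xi=\widehat\Xi\wedge\widehat\Xi=O$.
   Context: The parameters $a,b,c_1,c_2$ are indeterminates, $\lambda_1=a-c_2+1$, $\lambda_2=a-c_1+1$, $\lambda_3=c_1+c_2-a-2$, $\lambda_4=-b$, $\lambda_{123}=\lambda_1+\lambda_2+\lambda_3$, $\lambda_{134}^-=-(\lambda_1+\lambda_3+\lambda_4)$, $\lambda_{234}^-=-(\lambda_2+\lambda_3+\lambda_4)$; all vector spaces are over $\mathbb C(\lambda)=\mathbb C(\lambda_1,\dots,\lambda_4)$. (When complex values are assigned to the parameters, it is assumed that none of $a$, $a-c_1+1$, $a-c_2+1$, $a-c_1-c_2+2$, $b$, $b-c_1+1$, $b-c_2+1$, $b-c_1-c_2+2$ is an integer.) Put $R(x)=x_1^2+x_2^2-2x_1x_2-2x_1-2x_2+1$, $S=\{x_1x_2R(x)=0\}\cup L_\infty\subset\mathbb P^2$ ($L_\infty$ the line at infinity), $X=\mathbb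 P^2\setminus S$, $Q=Q(s)=s_1s_2-s_1-s_2$, $L=L(s,x)=1-s_1x_1-s_2x_2$, $\mathfrak X=\{(s,x)\in\mathbb C^2\times X\mid s_1s_2QL\ne0\}\subset(\mathbb P^1\times\mathbb P^1)\times\mathbb P^2$. Let $\Omega^{i,j}(\mathfrak X)$ be the space of rational $(i+j)$-forms on $(\mathbb P^1\times\mathbb P^1)\times\mathbb P^2$, with poles only along the complement of $\mathfrak X$, of degree $i$ in $ds_1,ds_2$ and degree $j$ in $dx_1,dx_2$. Let $d_s$, $d_x$, $d_y$ be the exterior derivatives in $s$, $x$, $y$. Set $\omega=\lambda_1\frac{ds_1}{s_1}+\lambda_2\frac{ds_2}{s_2}+\lambda_3\frac{d_sQ}{Q}+\lambda_4\frac{d_sL}{L}$, $\omega_X=-\frac{\lambda_4s_1dx_1}{L}-\frac{\lambda_4s_2dx_2}{L}$, $\nabla=d_s+\omega\wedge$, $\nabla_X=d_x+\omega_X\wedge$. Then $H^2(\Omega^{\bullet,0}(\mathfrak X),\nabla)=\Omega^{2,0}(\mathfrak X)/\nabla(\Omega^{1,0}(\mathfrak X))$ is regarded as a rank $4$ vector bundle over $X$ with frame given by the classes of $\varphi_1=\frac{ds_{12}}{s_1s_2}$, $\varphi_2=\frac{x_1ds_{12}}{s_2L}$, $\varphi_3=\frac{x_2ds_{12}}{s_1L}$, $\varphi_4=\frac{ds_{12}}{QL}$ ($ds_{12}=ds_1\wedge ds_2$), and $\nabla_X$ induces a connection on it with values in $\Omega^{2,1}(\mathfrak X)/\nabla(\Omega^{1,1}(\mathfrak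 X))$. Let $Y=\{(y_1,y_2)\in\mathbb C^2\mid y_1(1-y_1)y_2(1-y_2)(1-y_1-y_2)\neq0\}$ and let $pr:Y\to X$ be the (unramified double cover) map $(y_1,y_2)\mapsto(x_1,x_2)=(y_1(1-y_2),(1-y_1)y_2)$; one has $pr^*R(x)=(1-y_1-y_2)^2$. The pull-back bundle $pr^*H^2(\Omega^{\bullet,0}(\mathfrak X),\nabla)$ over $Y$ carries the pull-back connection $\nabla_Y=pr^*\nabla_X$ and has frame $\widetilde\varphi_i=pr^*(\varphi_i)$, $i=1,\dots,4$. Set $\widehat\varphi_i=\widetilde\varphi_i$ for $i=1,2,3$ and $\widehat\varphi_4=(1-y_1-y_2)\widetilde\varphi_4$. *)

theory Defs
  imports
    "HOL-Computational_Algebra.Polynomial"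
    "HOL-Computational_Algebra.Fraction_Field"
    "HOL-Library.Function_Algebras"
    "HOL-Analysis.Cartesian_Space"
begin

section \<open>The field of parameters \<open>\<complex>(\<lambda>)\<close>\<close>

text \<open>
  The parameters \<open>a, b, c\<^sub>1, c\<^sub>2\<close> are indeterminates. Since \<open>\<lambda>\<^sub>1, \<dots>, \<lambda>\<^sub>4\<close> below are related to
  them by an invertible affine transformation, \<open>\<complex>(a, b, c\<^sub>1, c\<^sub>2) = \<complex>(\<lambda>\<^sub>1, \<dots>, \<lambda>\<^sub>4)\<close>.
\<close>

type_synonym K = "complex poly poly poly poly fract"

definition par_a :: K where "par_a = Fract [:[:[:[:0, 1:]:]:]:] 1"
definition par_b :: K where "par_b = Fract [:[:[:0, 1:]:]:] 1"
definition par_c\<^sub>1 :: K where "par_c\<^sub>1 = Fract [:[:0, 1:]:] 1"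
definition par_c\<^sub>2 :: K where "par_c\<^sub>2 = Fract [:0, 1:] 1"

definition lam\<^sub>1 :: K where "lam\<^sub>1 = par_a - par_c\<^sub>2 + 1"
definition lam\<^sub>2 :: K where "lam\<^sub>2 = par_a - par_c\<^sub>1 + 1"
definition lam\<^sub>3 :: K where "lam\<^sub>3 = par_c\<^sub>1 + par_c\<^sub>2 - par_a - 2"
definition lam\<^sub>4 :: K where "lam\<^sub>4 = - par_b"
definition lam\<^sub>1\<^sub>2\<^sub>3 :: K where "lam\<^sub>1\<^sub>2\<^sub>3 = lam\<^sub>1 + lam\<^sub>2 + lam\<^sub>3"
definition lam\<^sub>1\<^sub>3\<^sub>4' :: K where "lam\<^sub>1\<^sub>3\<^sub>4' = - (lam\<^sub>1 + lam\<^sub>3 + lam\<^sub>4)"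
definition lam\<^sub>2\<^sub>3\<^sub>4' :: K where "lam\<^sub>2\<^sub>3\<^sub>4' = - (lam\<^sub>2 + lam\<^sub>3 + lam\<^sub>4)"


section \<open>Rational functions in four variables over \<open>\<complex>(\<lambda>)\<close>\<close>

text \<open>
  Four coordinates are numbered \<open>0, 1, 2, 3\<close>; coordinate \<open>0\<close> is the variable of the outermost
  polynomial ring, coordinate \<open>3\<close> that of the innermost one. The same field serves for functions
  of \<open>(s\<^sub>1, s\<^sub>2, x\<^sub>1, x\<^sub>2)\<close> and for functions of \<open>(s\<^sub>1, s\<^sub>2, y\<^sub>1, y\<^sub>2)\<close>; the two uses are related by
  the substitution homomorphism \<open>pr_fun\<close> below.
\<close>

type_synonym pol = "K poly poly poly poly"
type_synonym ratfun = "pol fract"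

definition cst :: "K \<Rightarrow> ratfun" where "cst c = Fract [:[:[:[:c:]:]:]:] 1"

definition s\<^sub>1 :: ratfun where "s\<^sub>1 = Fract [:0, 1:] 1"
definition s\<^sub>2 :: ratfun where "s\<^sub>2 = Fract [:[:0, 1:]:] 1"
definition x\<^sub>1 :: ratfun where "x\<^sub>1 = Fract [:[:[:0, 1:]:]:] 1"
definition x\<^sub>2 :: ratfun where "x\<^sub>2 = Fract [:[:[:[:0, 1:]:]:]:] 1"
definition y\<^sub>1 :: ratfun where "y\<^sub>1 = Fract [:[:[:0, 1:]:]:] 1"
definition y\<^sub>2 :: ratfun where "y\<^sub>2 = Fract [:[:[:[:0, 1:]:]:]:] 1"

definition pdiff :: "nat \<Rightarrow> pol \<Rightarrow> pol" where
  "pdiff i =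
     (if i = 0 then pderiv
      else if i = 1 then map_poly pderiv
      else if i = 2 then map_poly (map_poly pderiv)
      else map_poly (map_poly (map_poly pderiv)))"

definition derivation :: "('a \<Rightarrow> 'a :: comm_ring) \<Rightarrow> bool" where
  "derivation D \<longleftrightarrow> (\<forall>p q. D (p + q) = D p + D q \<and> D (p * q) = D p * q + p * D q)"

lemma derivation_pderiv: "derivation (pderiv :: 'a :: idom poly \<Rightarrow> _)"
  by (simp add: derivation_def pderiv_add pderiv_mult algebra_simps)

lemma derivation_map_poly:
  fixes D :: "'a :: idom \<Rightarrow> 'a"
  assumes "derivation D"
  shows "derivation (map_poly D)"
proof -
  have add: "D (p + q) = D p + D q" and mult: "D (p * q) = D p * q + p * D q" for p q
    using assms by (auto simp: derivation_def)
  have zero: "D 0 = 0"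
    using mult[of 0 0] by simp
  have sum: "D (\<Sum>i\<in>A. f i) = (\<Sum>i\<in>A. D (f i))" for f and A :: "nat set"
    by (induction A rule: infinite_finite_induct) (auto simp: zero add)
  have "map_poly D (p + q) = map_poly D p + map_poly D q" for p q
    by (rule poly_eqI) (simp add: coeff_map_poly zero add)
  moreover have "map_poly D (p * q) = map_poly D p * q + p * map_poly D q" for p q
    by (rule poly_eqI) (simp add: coeff_map_poly zero coeff_mult sum mult sum.distrib)
  ultimately show ?thesis
    by (simp add: derivation_def)
qed

lemma derivation_pdiff: "derivation (pdiff i)"
  by (simp add: pdiff_def derivation_pderiv derivation_map_poly)

text \<open>
  The partial derivative \<open>\<partial>/\<partial>z\<^sub>i\<close> on rational functions, by the quotient rule; \<open>pd_Fract\<close> shows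
  that the choice of numerator and denominator does not matter.
\<close>

definition pd :: "nat \<Rightarrow> ratfun \<Rightarrow> ratfun" where
  "pd i r = (THE v. \<exists>p q. q \<noteq> 0 \<and> r = Fract p q \<and>
               v = Fract (pdiff i p * q - p * pdiff i q) (q * q))"

lemma pd_Fract:
  assumes "q \<noteq> 0"
  shows "pd i (Fract p q) = Fract (pdiff i p * q - p * pdiff i q) (q * q)"
  unfolding pd_def
proof (rule the_equality)
  fix v
  assume "\<exists>p' q'. q' \<noteq> 0 \<and> Fract p q = Fract p' q' \<and>
            v = Fract (pdiff i p' * q' - p' * pdiff i q') (q' * q')"
  then obtain p' q' where q': "q' \<noteq> 0" and "Fract p q = Fract p' q'"
    and v: "v = Fract (pdiff i p' * q' - p' * pdiff i q') (q' * q')"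
    by blast
  then have eq: "p * q' = p' * q"
    using assms by (simp add: eq_fract)
  let ?D = "pdiff i"
  have mult: "?D (u * v) = ?D u * v + u * ?D v" for u v
    using derivation_pdiff by (simp add: derivation_def)
  have Deq: "?D p * q' + p * ?D q' = ?D p' * q + p' * ?D q"
    using arg_cong[OF eq, of ?D] by (simp add: mult)
  have "(?D p * q - p * ?D q) * (q' * q') - (?D p' * q' - p' * ?D q') * (q * q)
      = q * q' * (?D p * q' + p * ?D q' - (?D p' * q + p' * ?D q))
        - (p * q' - p' * q) * (q * ?D q' + q' * ?D q)"
    by (simp add: algebra_simps)
  also have "\<dots> = 0"
    by (simp add: eq Deq)
  finally have "(?D p * q - p * ?D q) * (q' * q') = (?D p' * q' - p' * ?D q') * (q * q)"
    by simp
  then show "v = Fract (?D p * q - p * ?D q) (q * q)"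
    using assms q' by (simp add: v eq_fract)
qed (use assms in blast)


section \<open>Rational differential forms\<close>

text \<open>
  A form is given by its coefficients: for \<open>I = {i\<^sub>1 < \<dots> < i\<^sub>k} \<subseteq> {0, 1, 2, 3}\<close>, \<open>\<alpha> I\<close> is the
  coefficient of \<open>dz\<^sub>i\<^sub>1 \<and> \<dots> \<and> dz\<^sub>i\<^sub>k\<close>, where \<open>z\<close> is \<open>(s\<^sub>1, s\<^sub>2, x\<^sub>1, x\<^sub>2)\<close> or \<open>(s\<^sub>1, s\<^sub>2, y\<^sub>1, y\<^sub>2)\<close>.
  Forms are added pointwise.
\<close>

type_synonym form = "nat set \<Rightarrow> ratfun"

definition scal :: "ratfun \<Rightarrow> form \<Rightarrow> form"  (infixr \<open>\<bullet>\<^sub>f\<close> 75) where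
  "f \<bullet>\<^sub>f \<alpha> = (\<lambda>I. f * \<alpha> I)"

definition shuffle_sign :: "nat set \<Rightarrow> nat set \<Rightarrow> ratfun" where
  "shuffle_sign J J' = (- 1) ^ card {(j, j') \<in> J \<times> J'. j' < j}"

definition wedge :: "form \<Rightarrow> form \<Rightarrow> form"  (infixr \<open>\<and>\<^sub>f\<close> 70) where
  "\<alpha> \<and>\<^sub>f \<beta> = (\<lambda>I. \<Sum>J\<in>Pow I. shuffle_sign J (I - J) * \<alpha> J * \<beta> (I - J))"

definition fn :: "ratfun \<Rightarrow> form" where
  "fn f = (\<lambda>I. if I = {} then f else 0)"

definition dz :: "nat \<Rightarrow> form" where
  "dz i = (\<lambda>I. if I = {i} then 1 else 0)"

definition ext_d :: "nat set \<Rightarrow> form \<Rightarrow> form" where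
  "ext_d V \<alpha> = (\<Sum>i\<in>V. dz i \<and>\<^sub>f (\<lambda>I. pd i (\<alpha> I)))"

definition d_s :: "form \<Rightarrow> form" where "d_s = ext_d {0, 1}"
definition d_x :: "form \<Rightarrow> form" where "d_x = ext_d {2, 3}"
definition d_y :: "form \<Rightarrow> form" where "d_y = ext_d {2, 3}"

definition ds\<^sub>1 :: form where "ds\<^sub>1 = dz 0"
definition ds\<^sub>2 :: form where "ds\<^sub>2 = dz 1"
definition dx\<^sub>1 :: form where "dx\<^sub>1 = dz 2"
definition dx\<^sub>2 :: form where "dx\<^sub>2 = dz 3"
definition dy\<^sub>1 :: form where "dy\<^sub>1 = dz 2"
definition dy\<^sub>2 :: form where "dy\<^sub>2 = dz 3"
definition ds\<^sub>1\<^sub>2 :: form where "ds\<^sub>1\<^sub>2 = ds\<^sub>1 \<and>\<^sub>f ds\<^sub>2"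

text \<open>Forms with coefficients in \<open>A\<close> of degree \<open>i\<close> in \<open>ds\<close> and of degree \<open>j\<close> in \<open>dx\<close> (or \<open>dy\<close>).\<close>

definition forms_over :: "ratfun set \<Rightarrow> nat \<Rightarrow> nat \<Rightarrow> form set" where
  "forms_over A i j =
     {\<alpha>. (\<forall>I. \<alpha> I \<in> A) \<and>
         (\<forall>I. \<alpha> I \<noteq> 0 \<longrightarrow> I \<subseteq> {0, 1, 2, 3} \<and> card (I \<inter> {0, 1}) = i \<and> card (I \<inter> {2, 3}) = j)}"


section \<open>The family \<open>\<XX> \<rightarrow> X\<close> and its twisted cohomology\<close>

definition Rx :: ratfun where
  "Rx = x\<^sub>1\<^sup>2 + x\<^sub>2\<^sup>2 - 2 * x\<^sub>1 * x\<^sub>2 - 2 * x\<^sub>1 - 2 * x\<^sub>2 + 1"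
definition Qs :: ratfun where "Qs = s\<^sub>1 * s\<^sub>2 - s\<^sub>1 - s\<^sub>2"
definition Lsx :: ratfun where "Lsx = 1 - s\<^sub>1 * x\<^sub>1 - s\<^sub>2 * x\<^sub>2"

text \<open>
  All hyperplanes at infinity lie in the complement of the affine variety \<open>\<XX>\<close>, so the rational
  functions with poles only along this complement are the elements of
  \<open>\<complex>(\<lambda>)[s, x][1 / (s\<^sub>1 s\<^sub>2 Q L x\<^sub>1 x\<^sub>2 R)]\<close>.
\<close>

definition O_XX :: "ratfun set" where
  "O_XX = {Fract p 1 / (s\<^sub>1 * s\<^sub>2 * Qs * Lsx * (x\<^sub>1 * x\<^sub>2 * Rx)) ^ n | p n. True}"

definition Omega :: "nat \<Rightarrow> nat \<Rightarrow> form set" where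
  "Omega i j = forms_over O_XX i j"

definition omega :: form where
  "omega = (cst lam\<^sub>1 / s\<^sub>1) \<bullet>\<^sub>f ds\<^sub>1 + (cst lam\<^sub>2 / s\<^sub>2) \<bullet>\<^sub>f ds\<^sub>2
         + (cst lam\<^sub>3 / Qs) \<bullet>\<^sub>f d_s (fn Qs) + (cst lam\<^sub>4 / Lsx) \<bullet>\<^sub>f d_s (fn Lsx)"

definition omega_X :: form where
  "omega_X = - ((cst lam\<^sub>4 * s\<^sub>1 / Lsx) \<bullet>\<^sub>f dx\<^sub>1) - (cst lam\<^sub>4 * s\<^sub>2 / Lsx) \<bullet>\<^sub>f dx\<^sub>2"

definition nabla :: "form \<Rightarrow> form" where "nabla \<alpha> = d_s \<alpha> + omega \<and>\<^sub>f \<alpha>"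
definition nabla_X :: "form \<Rightarrow> form" where "nabla_X \<alpha> = d_x \<alpha> + omega_X \<and>\<^sub>f \<alpha>"

definition phi :: "form ^ 4" where
  "phi = vector
     [(1 / (s\<^sub>1 * s\<^sub>2)) \<bullet>\<^sub>f ds\<^sub>1\<^sub>2,
      (x\<^sub>1 / (s\<^sub>2 * Lsx)) \<bullet>\<^sub>f ds\<^sub>1\<^sub>2,
      (x\<^sub>2 / (s\<^sub>1 * Lsx)) \<bullet>\<^sub>f ds\<^sub>1\<^sub>2,
      (1 / (Qs * Lsx)) \<bullet>\<^sub>f ds\<^sub>1\<^sub>2]"


section \<open>The pull-back by \<open>pr : Y \<rightarrow> X\<close>\<close>

text \<open>
  \<open>pr_pol\<close> is the homomorphism of \<open>\<complex>(\<lambda>)\<close>-algebras with \<open>s\<^sub>i \<mapsto> s\<^sub>i\<close>, \<open>x\<^sub>1 \<mapsto> y\<^sub>1 (1 - y\<^sub>2)\<close> and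
  \<open>x\<^sub>2 \<mapsto> (1 - y\<^sub>1) y\<^sub>2\<close>. It is extended to fractions whose denominator can be chosen with nonzero
  image; this covers \<open>O_XX\<close>, because \<open>pr\<^sup>*R = (1 - y\<^sub>1 - y\<^sub>2)\<^sup>2\<close>.
\<close>

definition pr_pol :: "pol \<Rightarrow> ratfun" where
  "pr_pol p =
     poly (map_poly (\<lambda>p. poly (map_poly (\<lambda>p. poly (map_poly (\<lambda>p. poly (map_poly cst p)
       ((1 - y\<^sub>1) * y\<^sub>2)) p) (y\<^sub>1 * (1 - y\<^sub>2))) p) s\<^sub>2) p) s\<^sub>1"

definition pr_fun :: "ratfun \<Rightarrow> ratfun" where
  "pr_fun r = (THE v. \<exists>p q. r = Fract p q \<and> pr_pol q \<noteq> 0 \<and> v = pr_pol p / pr_pol q)"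

definition pr_dz :: "nat \<Rightarrow> form" where
  "pr_dz i = ext_d {0, 1, 2, 3} (fn (pr_fun ([s\<^sub>1, s\<^sub>2, x\<^sub>1, x\<^sub>2] ! i)))"

definition pr_form :: "form \<Rightarrow> form" where
  "pr_form \<alpha> =
     (\<Sum>I\<in>Pow {0, 1, 2, 3}. pr_fun (\<alpha> I) \<bullet>\<^sub>f foldr wedge (map pr_dz (sorted_list_of_set I)) (fn 1))"

definition O_Y :: "ratfun set" where
  "O_Y = {Fract [:[:p:]:] 1 / (y\<^sub>1 * (1 - y\<^sub>1) * y\<^sub>2 * (1 - y\<^sub>2) * (1 - y\<^sub>1 - y\<^sub>2)) ^ n | p n. True}"

text \<open>
  For an \<open>O(X)\<close>-submodule \<open>N\<close> of \<open>\<Omega>\<^sup>i\<^sup>,\<^sup>j(\<XX>)\<close>, \<open>pr_module N\<close> is the \<open>O(Y)\<close>-span of \<open>pr\<^sup>*N\<close> in the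
  rational forms in \<open>(s, y)\<close>. Over \<open>N \<subseteq> \<Omega>\<^sup>2\<^sup>,\<^sup>0\<close> it is \<open>O(Y) \<otimes> N\<close>, as \<open>pr\<close> is flat; over
  \<open>N \<subseteq> \<Omega>\<^sup>2\<^sup>,\<^sup>1\<close> the identification \<open>pr\<^sup>*\<Omega>\<^sup>1\<^sub>X = \<Omega>\<^sup>1\<^sub>Y\<close> (\<open>pr\<close> is unramified) is used in addition. The
  pull-back of the bundle \<open>\<Omega>\<^sup>2\<^sup>,\<^sup>0(\<XX>) / \<nabla>(\<Omega>\<^sup>1\<^sup>,\<^sup>0(\<XX>))\<close> is thus \<open>pr_module (Omega 2 0)\<close> modulo
  \<open>pr_module (nabla ` Omega 1 0)\<close>, and \<open>1\<close>-forms on \<open>Y\<close> with values in it are the elements of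
  \<open>pr_module (Omega 2 1)\<close> modulo \<open>pr_module (nabla ` Omega 1 1)\<close>.
\<close>

definition pr_module :: "form set \<Rightarrow> form set" where
  "pr_module N = {\<Sum>k<n. f k \<bullet>\<^sub>f pr_form (\<eta> k) | (n :: nat) f \<eta>. \<forall>k<n. f k \<in> O_Y \<and> \<eta> k \<in> N}"

definition same_class :: "form set \<Rightarrow> form \<Rightarrow> form \<Rightarrow> bool" where
  "same_class N \<alpha> \<beta> \<longleftrightarrow> \<alpha> - \<beta> \<in> N"

text \<open>
  The pull-back connection \<open>pr\<^sup>*\<nabla>\<^sub>X\<close>: by the chain rule it is the map with
  \<open>\<nabla>\<^sub>Y(f pr\<^sup>*\<eta>) = d\<^sub>y f \<and> pr\<^sup>*\<eta> + f pr\<^sup>*(\<nabla>\<^sub>X \<eta>)\<close> for \<open>f \<in> O(Y)\<close>.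
\<close>

definition nabla_Y :: "form \<Rightarrow> form" where
  "nabla_Y u = d_y u + pr_form omega_X \<and>\<^sub>f u"

definition is_frame :: "form ^ 4 \<Rightarrow> bool" where
  "is_frame e \<longleftrightarrow>
     (\<forall>i. e $ i \<in> pr_module (Omega 2 0)) \<and>
     (\<forall>u \<in> pr_module (Omega 2 0). \<exists>!c :: ratfun ^ 4. (\<forall>i. c $ i \<in> O_Y) \<and>
        same_class (pr_module (nabla ` Omega 1 0)) u (\<Sum>i\<in>UNIV. c $ i \<bullet>\<^sub>f e $ i))"

text \<open>\<open>M\<close> is a matrix of \<open>1\<close>-forms on \<open>Y\<close> with \<open>\<nabla>\<^sub>Y \<^sup>te = M \<and> \<^sup>te\<close> for \<open>\<^sup>te = \<^sup>t(e\<^sub>1, \<dots>, e\<^sub>4)\<close>.\<close>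

definition is_connection_matrix :: "form ^ 4 \<Rightarrow> form ^ 4 ^ 4 \<Rightarrow> bool" where
  "is_connection_matrix e M \<longleftrightarrow>
     (\<forall>i j. M $ i $ j \<in> forms_over O_Y 0 1) \<and>
     (\<forall>i. e $ i \<in> pr_module (Omega 2 0) \<and>
          nabla_Y (e $ i) \<in> pr_module (Omega 2 1) \<and>
          same_class (pr_module (nabla ` Omega 1 1))
            (nabla_Y (e $ i)) (\<Sum>j\<in>UNIV. M $ i $ j \<and>\<^sub>f e $ j))"

definition phi_tilde :: "form ^ 4" where
  "phi_tilde = (\<chi> i. pr_form (phi $ i))"

definition phi_hat :: "form ^ 4" where
  "phi_hat = vector
     [phi_tilde $ 1, phi_tilde $ 2, phi_tilde $ 3, (1 - y\<^sub>1 - y\<^sub>2) \<bullet>\<^sub>f phi_tilde $ 4]"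


section \<open>The connection matrix\<close>

definition Xi\<^sub>1 :: "K ^ 4 ^ 4" where
  "Xi\<^sub>1 = vector
    [vector [0, - lam\<^sub>4, 0, 0],
     vector [0, - lam\<^sub>1 - lam\<^sub>3, 0, 0],
     vector [- lam\<^sub>1\<^sub>2\<^sub>3 / 2, (- lam\<^sub>2 + lam\<^sub>4) / 2, (- lam\<^sub>1 + lam\<^sub>4) / 2, - lam\<^sub>3 / 2],
     vector [(lam\<^sub>1\<^sub>3\<^sub>4' - lam\<^sub>3) * lam\<^sub>1\<^sub>2\<^sub>3 / (2 * lam\<^sub>3),
             lam\<^sub>4 + (lam\<^sub>2 + lam\<^sub>4) * (lam\<^sub>1 + lam\<^sub>4) / (2 * lam\<^sub>3),
             (lam\<^sub>1 - lam\<^sub>4) * (lam\<^sub>1\<^sub>3\<^sub>4' - lam\<^sub>3) / (2 * lam\<^sub>3),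
             (lam\<^sub>1\<^sub>3\<^sub>4' - lam\<^sub>3) / 2]]"

definition Xi\<^sub>2 :: "K ^ 4 ^ 4" where
  "Xi\<^sub>2 = vector
    [vector [0, 0, - lam\<^sub>4, 0],
     vector [- lam\<^sub>1\<^sub>2\<^sub>3 / 2, (- lam\<^sub>2 + lam\<^sub>4) / 2, (- lam\<^sub>1 + lam\<^sub>4) / 2, - lam\<^sub>3 / 2],
     vector [0, 0, - lam\<^sub>3 - lam\<^sub>2, 0],
     vector [(lam\<^sub>2\<^sub>3\<^sub>4' - lam\<^sub>3) * lam\<^sub>1\<^sub>2\<^sub>3 / (2 * lam\<^sub>3),
             (lam\<^sub>2 - lam\<^sub>4) * (lam\<^sub>2\<^sub>3\<^sub>4' - lam\<^sub>3) / (2 * lam\<^sub>3),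
             lam\<^sub>4 + (lam\<^sub>2 + lam\<^sub>4) * (lam\<^sub>1 + lam\<^sub>4) / (2 * lam\<^sub>3),
             (lam\<^sub>2\<^sub>3\<^sub>4' - lam\<^sub>3) / 2]]"

definition diag4 :: "K \<Rightarrow> K \<Rightarrow> K \<Rightarrow> K \<Rightarrow> K ^ 4 ^ 4" where
  "diag4 a b c d = (\<chi> i j. if i = j then vector [a, b, c, d] $ i else 0)"

definition Xi\<^sub>3 :: "K ^ 4 ^ 4" where "Xi\<^sub>3 = diag4 0 0 0 (2 * (lam\<^sub>3 + lam\<^sub>4))"
definition I\<^sub>3\<^sub>1 :: "K ^ 4 ^ 4" where "I\<^sub>3\<^sub>1 = diag4 1 1 1 (- 1)"

definition mat_form :: "K ^ 4 ^ 4 \<Rightarrow> form \<Rightarrow> form ^ 4 ^ 4" where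
  "mat_form A \<theta> = (\<chi> i j. cst (A $ i $ j) \<bullet>\<^sub>f \<theta>)"

definition Xi_hat :: "form ^ 4 ^ 4" where
  "Xi_hat =
     mat_form Xi\<^sub>1 ((1 / y\<^sub>1) \<bullet>\<^sub>f dy\<^sub>1)
   + mat_form Xi\<^sub>2 ((1 / y\<^sub>2) \<bullet>\<^sub>f dy\<^sub>2)
   + mat_form (I\<^sub>3\<^sub>1 ** Xi\<^sub>2 ** matrix_inv I\<^sub>3\<^sub>1) ((1 / (y\<^sub>1 - 1)) \<bullet>\<^sub>f dy\<^sub>1)
   + mat_form (I\<^sub>3\<^sub>1 ** Xi\<^sub>1 ** matrix_inv I\<^sub>3\<^sub>1) ((1 / (y\<^sub>2 - 1)) \<bullet>\<^sub>f dy\<^sub>2)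
   + mat_form Xi\<^sub>3 ((1 / (y\<^sub>1 + y\<^sub>2 - 1)) \<bullet>\<^sub>f (dy\<^sub>1 + dy\<^sub>2))"

definition d_y_mat :: "form ^ 4 ^ 4 \<Rightarrow> form ^ 4 ^ 4" where
  "d_y_mat M = (\<chi> i j. d_y (M $ i $ j))"

definition wedge_mat :: "form ^ 4 ^ 4 \<Rightarrow> form ^ 4 ^ 4 \<Rightarrow> form ^ 4 ^ 4" where
  "wedge_mat M N = (\<chi> i j. \<Sum>k\<in>UNIV. M $ i $ k \<and>\<^sub>f N $ k $ j)"

end

theory Submission
  imports Defs
begin

text \<open>
  With \<open>U = s\<^sub>1 powr \<lambda>\<^sub>1 * s\<^sub>2 powr \<lambda>\<^sub>2 * Q powr \<lambda>\<^sub>3 * L powr \<lambda>\<^sub>4\<close>, the class of \<open>f ds\<^sub>1\<^sub>2\<close> stands for the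
  integrals of \<open>U f ds\<^sub>1\<^sub>2\<close>, and the exact forms are
  \<open>\<nabla>(g\<^sub>1 ds\<^sub>2 - g\<^sub>2 ds\<^sub>1) = twisted_div g\<^sub>1 g\<^sub>2 ds\<^sub>1\<^sub>2\<close>, the total derivatives. Finding the connection
  matrix is therefore integration by parts: differentiating \<open>\<phi>\<^sub>i\<close> in \<open>x\<close> raises the pole order along
  \<open>L = 0\<close>, and twisted divergences lower it again.

  Seven vector fields suffice. All are tangent to \<open>Q = 0\<close> or have no pole there, so that no pole of
  order two along \<open>Q = 0\<close> appears. The first five (\<open>rel_a\<close> to \<open>rel_e\<close>) express \<open>1 / L\<^sup>2\<close>,
  \<open>s\<^sub>1 / (Q L)\<close>, \<open>s\<^sub>2 / (Q L)\<close> and the derivatives of \<open>\<phi>\<^sub>2\<close> and \<open>\<phi>\<^sub>3\<close> by the frame. The last two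
  (\<open>rel_g\<close>, \<open>rel_h\<close>) give a linear system for the two derivatives of \<open>\<phi>\<^sub>4\<close>, with matrix
  \<open>((1 - x\<^sub>1 - x\<^sub>2, - 2 x\<^sub>2), (- 2 x\<^sub>1, 1 - x\<^sub>1 - x\<^sub>2))\<close>. Its determinant is \<open>R\<close>, and \<open>pr\<^sup>*R = \<delta>\<^sup>2\<close> with
  \<open>\<delta> = 1 - y\<^sub>1 - y\<^sub>2\<close>. On \<open>Y\<close> the combinations of the two equations with coefficients
  \<open>(1 - y\<^sub>2, y\<^sub>2)\<close> and \<open>(y\<^sub>1, 1 - y\<^sub>1)\<close> have as left-hand sides exactly \<open>\<delta>\<close> times the derivatives of
  \<open>\<phi>\<^sub>4\<close> along \<open>y\<^sub>1\<close> and \<open>y\<^sub>2\<close>. This is why rescaling \<open>\<phi>\<^sub>4\<close> by \<open>\<delta>\<close> leaves only simple poles with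
  constant residues. Comparing coefficients (\<open>reduced_derivative_exact\<close>) gives the connection matrix.

  Uniqueness (\<open>connection_matrix_unique\<close>): the coefficient of \<open>dy\<^sub>1\<close> or \<open>dy\<^sub>2\<close> in an exact
  \<open>(2,1)\<close>-form is an exact \<open>(2,0)\<close>-form, so the difference of two connection matrices yields
  \<open>O(Y)\<close>-linear relations among the classes of the frame, and these are trivial.

  Flatness: every entry is a constant combination of closed logarithmic forms, so
  \<open>d\<^sub>y\<Xi> = 0\<close>. The coefficient of \<open>dy\<^sub>1 \<and> dy\<^sub>2\<close> in \<open>\<Xi> \<and> \<Xi>\<close> is a sum of commutators of residue
  matrices over pairs of polar lines. Where two polar lines cross normally the residues commute; at
  the two points where three polar lines meet, the three commutators cancel by a partial fraction
  identity (\<open>inverse_triangle\<close>, \<open>conn_commute\<close>).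
\<close>

section \<open>Partial derivatives of rational functions\<close>

lemma pdiff_add: "pdiff i (p + q) = pdiff i p + pdiff i q"
  and pdiff_mult: "pdiff i (p * q) = pdiff i p * q + p * pdiff i q"
  using derivation_pdiff[of i] by (auto simp: derivation_def)

lemma pd_add: "pd i (f + g) = pd i f + pd i g"
proof (cases f, cases g)
  fix a b c d assume f: "f = Fract a b" "b \<noteq> 0" and g: "g = Fract c d" "d \<noteq> 0"
  then show ?thesis
    by (simp add: pd_Fract pdiff_add pdiff_mult eq_fract algebra_simps)
qed

lemma pd_mult: "pd i (f * g) = pd i f * g + f * pd i g"
proof (cases f, cases g)
  fix a b c d assume f: "f = Fract a b" "b \<noteq> 0" and g: "g = Fract c d" "d \<noteq> 0"
  then show ?thesis
    by (simp add: pd_Fract pdiff_mult eq_fract algebra_simps)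
qed

lemma pd_0 [simp]: "pd i 0 = 0"
  by (metis pd_add add_0 add_cancel_right_left)

lemma pd_1 [simp]: "pd i 1 = 0"
  using pd_mult[of i 1 1] by (metis add_cancel_right_left mult_1 mult_1_right)

lemma pd_2 [simp]: "pd i 2 = 0"
  using pd_add[of i 1 1] by simp

lemma pd_minus: "pd i (- f) = - pd i f"
  using pd_add[of i f "- f"] by (simp add: eq_neg_iff_add_eq_0 add.commute)

lemma pd_diff: "pd i (f - g) = pd i f - pd i g"
  using pd_add[of i f "- g"] by (simp add: pd_minus)

lemma pd_divide: "pd i (f / g) = (pd i f * g - f * pd i g) / (g * g)"
proof (cases "g = 0")
  case False
  then have "pd i f = pd i (f / g) * g + f / g * pd i g"
    using pd_mult[of i "f / g" g] by simp
  with False show ?thesis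
    by (simp add: field_simps)
qed simp

lemma pdiff_1: "pdiff i 1 = 0"
  using pdiff_mult[of i 1 1] by (metis add_cancel_right_left mult_1 mult_1_right)

lemma pd_poly: "pd i (Fract p 1) = Fract (pdiff i p) 1"
  by (simp add: pd_Fract pdiff_1)

lemma pd_cst [simp]: "pd i (cst c) = 0"
  by (simp add: cst_def pd_poly pdiff_def map_poly_pCons pderiv_pCons fract_collapse)

lemma pd_s\<^sub>1: "pd 0 s\<^sub>1 = 1" "pd (Suc 0) s\<^sub>1 = 0" "pd 2 s\<^sub>1 = 0" "pd 3 s\<^sub>1 = 0"
  and pd_s\<^sub>2: "pd 0 s\<^sub>2 = 0" "pd (Suc 0) s\<^sub>2 = 1" "pd 2 s\<^sub>2 = 0" "pd 3 s\<^sub>2 = 0"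
  and pd_x\<^sub>1: "pd 0 x\<^sub>1 = 0" "pd (Suc 0) x\<^sub>1 = 0" "pd 2 x\<^sub>1 = 1" "pd 3 x\<^sub>1 = 0"
  and pd_x\<^sub>2: "pd 0 x\<^sub>2 = 0" "pd (Suc 0) x\<^sub>2 = 0" "pd 2 x\<^sub>2 = 0" "pd 3 x\<^sub>2 = 1"
  by (simp_all add: s\<^sub>1_def s\<^sub>2_def x\<^sub>1_def x\<^sub>2_def pd_poly pdiff_def map_poly_pCons
      pderiv_pCons fract_collapse map_poly_1, (simp add: fract_collapse flip: one_pCons)+)

lemma y\<^sub>1_eq: "y\<^sub>1 = x\<^sub>1" and y\<^sub>2_eq: "y\<^sub>2 = x\<^sub>2"
  by (simp_all add: x\<^sub>1_def y\<^sub>1_def x\<^sub>2_def y\<^sub>2_def)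

lemmas pd_simps = pd_add pd_mult pd_minus pd_diff pd_divide pd_s\<^sub>1 pd_s\<^sub>2 pd_x\<^sub>1 pd_x\<^sub>2
  pd_x\<^sub>1[folded y\<^sub>1_eq] pd_x\<^sub>2[folded y\<^sub>2_eq]

section \<open>Constants and nonvanishing\<close>

lemma numeral_neq_zero_fract: "(numeral w :: ('a :: {idom, ring_char_0}) fract) \<noteq> 0"
proof
  assume "(numeral w :: 'a fract) = 0"
  then have "Fract (numeral w :: 'a) 1 = Fract 0 1"
    using of_nat_fract[of "numeral w", where 'a = 'a] by (simp add: Zero_fract_def)
  then show False
    by (simp add: eq_fract)
qed

lemma numeral_neq_zero_K: "(numeral w :: K) \<noteq> 0"
  by (rule numeral_neq_zero_fract)

lemma cst_add: "cst (c + d) = cst c + cst d"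
  and cst_minus: "cst (- c) = - cst c"
  and cst_diff: "cst (c - d) = cst c - cst d"
  and cst_mult: "cst (c * d) = cst c * cst d"
  and cst_0 [simp]: "cst 0 = 0"
  and cst_1 [simp]: "cst 1 = 1"
  by (simp_all add: cst_def fract_collapse flip: One_fract_def one_pCons)

lemma cst_eq_0_iff [simp]: "cst c = 0 \<longleftrightarrow> c = 0"
  by (simp add: cst_def Zero_fract_def eq_fract)

lemma cst_divide: "cst (c / d) = cst c / cst d"
proof (cases "d = 0")
  case False
  then have "cst (c / d) * cst d = cst c"
    by (simp flip: cst_mult)
  with False show ?thesis
    by (simp add: field_simps)
qed simp

lemma cst_numeral: "cst (numeral w) = numeral w"
proof -
  have "cst (of_nat n) = of_nat n" for n
    by (induction n) (simp_all add: cst_add)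
  from this[of "numeral w"] show ?thesis
    by simp
qed

lemma numeral_neq_zero: "(numeral w :: ratfun) \<noteq> 0"
  using numeral_neq_zero_K[of w] by (simp flip: cst_numeral)

lemma lam\<^sub>3_nz: "lam\<^sub>3 \<noteq> 0"
proof -
  have two: "(2 :: K) = Fract 2 1"
    using of_nat_fract[of 2, where 'a = "complex poly poly poly poly"] by simp
  show ?thesis
    by (simp add: lam\<^sub>3_def par_a_def par_c\<^sub>1_def par_c\<^sub>2_def two Zero_fract_def eq_fract
        numeral_poly)
qed

lemma s\<^sub>1_nz: "s\<^sub>1 \<noteq> 0"
  using pd_s\<^sub>1(1) by auto
lemma s\<^sub>2_nz: "s\<^sub>2 \<noteq> 0"
  using pd_s\<^sub>2(2) by auto
lemma x\<^sub>1_nz: "x\<^sub>1 \<noteq> 0"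
  using pd_x\<^sub>1(3) by auto
lemma x\<^sub>2_nz: "x\<^sub>2 \<noteq> 0"
  using pd_x\<^sub>2(4) by auto

text \<open>
  A rational function with a nonzero iterated derivative is nonzero. This settles the nonvanishing
  of all denominators by differentiation, without inspecting numerators as nested polynomials.
\<close>

lemma nonzero_if_pd: "pd i f \<noteq> 0 \<Longrightarrow> f \<noteq> 0"
  by auto

lemma Qs_nz: "Qs \<noteq> 0"
proof (rule nonzero_if_pd[of 0], rule nonzero_if_pd[of "Suc 0"])
  show "pd (Suc 0) (pd 0 Qs) \<noteq> 0"
    by (simp add: Qs_def pd_simps)
qed

lemma Lsx_nz: "Lsx \<noteq> 0"
proof (rule nonzero_if_pd[of 0], rule nonzero_if_pd[of 2])
  show "pd 2 (pd 0 Lsx) \<noteq> 0"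
    by (simp add: Lsx_def pd_simps)
qed

lemma Rx_nz: "Rx \<noteq> 0"
proof (rule nonzero_if_pd[of 2], rule nonzero_if_pd[of 3])
  show "pd 3 (pd 2 Rx) \<noteq> 0"
    by (simp add: numeral_neq_zero Rx_def power2_eq_square pd_simps)
qed

lemma y_nz:
  "y\<^sub>1 \<noteq> 0" "y\<^sub>2 \<noteq> 0" "1 - y\<^sub>1 \<noteq> 0" "1 - y\<^sub>2 \<noteq> 0" "y\<^sub>1 - 1 \<noteq> 0" "y\<^sub>2 - 1 \<noteq> 0"
  "1 - y\<^sub>1 - y\<^sub>2 \<noteq> 0" "y\<^sub>1 + y\<^sub>2 - 1 \<noteq> 0"
  by (rule nonzero_if_pd[of 2] nonzero_if_pd[of 3], simp add: pd_simps; fail)+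

text \<open>
  The same inequations in the form to which the simplifier reduces a nonzero difference.
\<close>

lemma y_nz':
  "y\<^sub>1 \<noteq> 1" "y\<^sub>2 \<noteq> 1" "1 - y\<^sub>1 \<noteq> y\<^sub>2" "1 \<noteq> y\<^sub>1" "1 \<noteq> y\<^sub>2"
  using y_nz by auto

section \<open>Pull-back of functions along \<open>pr\<close>\<close>

definition is_ring_hom :: "('a :: comm_ring_1 \<Rightarrow> 'b :: comm_ring_1) \<Rightarrow> bool" where
  "is_ring_hom h \<longleftrightarrow> h 1 = 1 \<and> (\<forall>a b. h (a + b) = h a + h b \<and> h (a * b) = h a * h b)"

lemma is_ring_hom_0: "is_ring_hom h \<Longrightarrow> h 0 = 0"
  unfolding is_ring_hom_def by (metis add_0 add_cancel_right_left)

lemma is_ring_hom_minus: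
  assumes "is_ring_hom h"
  shows "h (- a) = - h a"
proof -
  have "h (- a) + h a = h (- a + a)"
    using assms unfolding is_ring_hom_def by metis
  then show ?thesis
    by (simp add: is_ring_hom_0[OF assms] eq_neg_iff_add_eq_0)
qed

lemma is_ring_hom_eval:
  fixes h :: "'a :: comm_ring_1 \<Rightarrow> 'b :: comm_ring_1"
  assumes h: "is_ring_hom h"
  shows "is_ring_hom (\<lambda>p. poly (map_poly h p) z)"
proof -
  have zero: "h 0 = 0" and add: "h (a + b) = h a + h b" and mult: "h (a * b) = h a * h b"
    and one: "h 1 = 1" for a b
    using h is_ring_hom_0[OF h] by (auto simp: is_ring_hom_def)
  have sum: "h (\<Sum>i\<in>A. f i) = (\<Sum>i\<in>A. h (f i))" for f and A :: "nat set"
    by (induction A rule: infinite_finite_induct) (auto simp: zero add)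
  have "map_poly h (p + q) = map_poly h p + map_poly h q" for p q
    by (rule poly_eqI) (simp add: coeff_map_poly zero add)
  moreover have "map_poly h (p * q) = map_poly h p * map_poly h q" for p q
    by (rule poly_eqI) (simp add: coeff_map_poly zero coeff_mult sum mult)
  ultimately show ?thesis
    by (simp add: is_ring_hom_def one)
qed

lemma is_ring_hom_cst: "is_ring_hom cst"
  by (simp add: is_ring_hom_def cst_add cst_mult)

abbreviation pr_x\<^sub>1 :: ratfun where "pr_x\<^sub>1 \<equiv> y\<^sub>1 * (1 - y\<^sub>2)"
abbreviation pr_x\<^sub>2 :: ratfun where "pr_x\<^sub>2 \<equiv> (1 - y\<^sub>1) * y\<^sub>2"

lemma is_ring_hom_pr_pol: "is_ring_hom pr_pol"
proof -
  note eval = is_ring_hom_eval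
  have "is_ring_hom (\<lambda>p. pr_pol p)"
    unfolding pr_pol_def by (intro eval is_ring_hom_cst)
  then show ?thesis
    by simp
qed

lemma pr_pol_0 [simp]: "pr_pol 0 = 0" and pr_pol_1 [simp]: "pr_pol 1 = 1"
  and pr_pol_add: "pr_pol (p + q) = pr_pol p + pr_pol q"
  and pr_pol_mult: "pr_pol (p * q) = pr_pol p * pr_pol q"
  and pr_pol_minus: "pr_pol (- p) = - pr_pol p"
  using is_ring_hom_pr_pol is_ring_hom_0[OF is_ring_hom_pr_pol]
    is_ring_hom_minus[OF is_ring_hom_pr_pol] by (auto simp: is_ring_hom_def)

text \<open>
  The graph of \<open>pr_fun\<close>. As a relation it can be derived by following the structure of an
  expression, where the only obligations are that the pulled-back denominators do not vanish.
\<close>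

definition has_pullback :: "ratfun \<Rightarrow> ratfun \<Rightarrow> bool" where
  "has_pullback f v \<longleftrightarrow> (\<exists>p q. f = Fract p q \<and> pr_pol q \<noteq> 0 \<and> v = pr_pol p / pr_pol q)"

lemma has_pullback_unique:
  assumes "has_pullback f v" "has_pullback f v'"
  shows "v = v'"
proof -
  obtain p q p' q' where f: "f = Fract p q" "f = Fract p' q'"
    and q: "pr_pol q \<noteq> 0" "pr_pol q' \<noteq> 0"
    and v: "v = pr_pol p / pr_pol q" "v' = pr_pol p' / pr_pol q'"
    using assms unfolding has_pullback_def by blast
  have "q \<noteq> 0" "q' \<noteq> 0"
    using q by auto
  with f have "pr_pol (p * q') = pr_pol (p' * q)"
    by (simp add: eq_fract)
  with q show ?thesis
    by (simp add: v pr_pol_mult field_simps)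
qed

lemma pr_fun_eqI: "has_pullback f v \<Longrightarrow> pr_fun f = v"
  unfolding pr_fun_def has_pullback_def[symmetric]
  using has_pullback_unique by blast

lemma has_pullback_poly: "has_pullback (Fract p 1) (pr_pol p)"
  unfolding has_pullback_def by (intro exI[of _ p] exI[of _ 1]) simp

lemma has_pullback_add:
  assumes "has_pullback f v" "has_pullback g w"
  shows "has_pullback (f + g) (v + w)"
proof -
  obtain p q p' q' where *: "f = Fract p q" "pr_pol q \<noteq> 0" "v = pr_pol p / pr_pol q"
    "g = Fract p' q'" "pr_pol q' \<noteq> 0" "w = pr_pol p' / pr_pol q'"
    using assms unfolding has_pullback_def by blast
  then have "q \<noteq> 0" "q' \<noteq> 0"
    by auto
  with * show ?thesis
    unfolding has_pullback_def
    by (intro exI[of _ "p * q' + p' * q"] exI[of _ "q * q'"])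
      (simp add: pr_pol_add pr_pol_mult field_simps)
qed

lemma has_pullback_minus: "has_pullback f v \<Longrightarrow> has_pullback (- f) (- v)"
  unfolding has_pullback_def
  by (metis minus_fract pr_pol_minus minus_divide_left)

lemma has_pullback_diff:
  "has_pullback f v \<Longrightarrow> has_pullback g w \<Longrightarrow> has_pullback (f - g) (v - w)"
  using has_pullback_add[of f v "- g" "- w"] has_pullback_minus[of g w] by simp

lemma has_pullback_mult:
  assumes "has_pullback f v" "has_pullback g w"
  shows "has_pullback (f * g) (v * w)"
proof -
  obtain p q p' q' where *: "f = Fract p q" "pr_pol q \<noteq> 0" "v = pr_pol p / pr_pol q"
    "g = Fract p' q'" "pr_pol q' \<noteq> 0" "w = pr_pol p' / pr_pol q'"
    using assms unfolding has_pullback_def by blast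
  then show ?thesis
    unfolding has_pullback_def
    by (intro exI[of _ "p * p'"] exI[of _ "q * q'"]) (simp add: pr_pol_mult)
qed

lemma has_pullback_divide:
  assumes "has_pullback f v" "has_pullback g w" "w \<noteq> 0"
  shows "has_pullback (f / g) (v / w)"
proof -
  obtain p q p' q' where *: "f = Fract p q" "pr_pol q \<noteq> 0" "v = pr_pol p / pr_pol q"
    "g = Fract p' q'" "pr_pol q' \<noteq> 0" "w = pr_pol p' / pr_pol q'"
    using assms unfolding has_pullback_def by blast
  with \<open>w \<noteq> 0\<close> show ?thesis
    unfolding has_pullback_def
    by (intro exI[of _ "p * q'"] exI[of _ "q * p'"]) (simp add: pr_pol_mult)
qed

lemma has_pullback_0: "has_pullback 0 0"
  and has_pullback_1: "has_pullback 1 1"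
  and has_pullback_cst: "has_pullback (cst c) (cst c)"
  and has_pullback_s\<^sub>1: "has_pullback s\<^sub>1 s\<^sub>1"
  and has_pullback_s\<^sub>2: "has_pullback s\<^sub>2 s\<^sub>2"
  and has_pullback_x\<^sub>1: "has_pullback x\<^sub>1 pr_x\<^sub>1"
  and has_pullback_x\<^sub>2: "has_pullback x\<^sub>2 pr_x\<^sub>2"
proof -
  have Fr: "has_pullback (Fract p 1) v" if "v = pr_pol p" for p v
    using that has_pullback_poly by simp
  show "has_pullback 0 0" "has_pullback 1 1"
    by (simp_all add: Zero_fract_def One_fract_def Fr)
  show "has_pullback (cst c) (cst c)"
    by (subst (1) cst_def, rule Fr) (simp add: pr_pol_def map_poly_pCons)
  show "has_pullback s\<^sub>1 s\<^sub>1"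
    by (subst (1) s\<^sub>1_def, rule Fr) (simp add: pr_pol_def map_poly_pCons)
  show "has_pullback s\<^sub>2 s\<^sub>2"
    by (subst (1) s\<^sub>2_def, rule Fr) (simp add: pr_pol_def map_poly_pCons)
  show "has_pullback x\<^sub>1 pr_x\<^sub>1"
    by (subst (1) x\<^sub>1_def, rule Fr) (simp add: pr_pol_def map_poly_pCons)
  show "has_pullback x\<^sub>2 pr_x\<^sub>2"
    by (subst (1) x\<^sub>2_def, rule Fr) (simp add: pr_pol_def map_poly_pCons)
qed

lemmas has_pullback_intros = has_pullback_0 has_pullback_1 has_pullback_cst has_pullback_s\<^sub>1
  has_pullback_s\<^sub>2 has_pullback_x\<^sub>1 has_pullback_x\<^sub>2 has_pullback_add has_pullback_minus
  has_pullback_diff has_pullback_mult has_pullback_divide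

lemma pr_fun_0 [simp]: "pr_fun 0 = 0"
  by (rule pr_fun_eqI has_pullback_0)+

section \<open>The coordinate rings\<close>

definition is_subring :: "ratfun set \<Rightarrow> bool" where
  "is_subring A \<longleftrightarrow> 1 \<in> A \<and> (\<forall>f\<in>A. \<forall>g\<in>A. f - g \<in> A \<and> f * g \<in> A)"

lemma is_subringD:
  assumes "is_subring A"
  shows "1 \<in> A" "0 \<in> A" "f \<in> A \<Longrightarrow> - f \<in> A" "f \<in> A \<Longrightarrow> g \<in> A \<Longrightarrow> f + g \<in> A"
    "f \<in> A \<Longrightarrow> g \<in> A \<Longrightarrow> f - g \<in> A" "f \<in> A \<Longrightarrow> g \<in> A \<Longrightarrow> f * g \<in> A"
proof -
  have 1: "1 \<in> A" and d: "f \<in> A \<Longrightarrow> g \<in> A \<Longrightarrow> f - g \<in> A"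
    and m: "f \<in> A \<Longrightarrow> g \<in> A \<Longrightarrow> f * g \<in> A" for f g
    using assms by (auto simp: is_subring_def)
  show 0: "0 \<in> A"
    using d[OF 1 1] by simp
  then show neg: "f \<in> A \<Longrightarrow> - f \<in> A" for f
    using d[of 0 f] by simp
  show "f \<in> A \<Longrightarrow> g \<in> A \<Longrightarrow> f + g \<in> A"
    using d[of f "- g"] neg[of g] by simp
  show "1 \<in> A" "f \<in> A \<Longrightarrow> g \<in> A \<Longrightarrow> f - g \<in> A" "f \<in> A \<Longrightarrow> g \<in> A \<Longrightarrow> f * g \<in> A"
    by (fact 1 d m)+
qed

text \<open>
  Both coordinate rings arise from a polynomial ring by inverting one element, so closure under the
  ring operations and invertibility of the factors of that element need only be shown once.
\<close>

definition localization :: "ratfun set \<Rightarrow> ratfun \<Rightarrow> ratfun set" where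
  "localization B d = {b / d ^ n | b n. b \<in> B}"

lemma base_subset_localization: "B \<subseteq> localization B d"
  unfolding localization_def by (auto intro!: exI[of _ "0 :: nat"])

lemma is_subring_localization:
  assumes B: "is_subring B" and d: "d \<in> B" "d \<noteq> 0"
  shows "is_subring (localization B d)"
  unfolding is_subring_def
proof (intro conjI ballI)
  note sub = is_subringD[OF B]
  have pow: "d ^ n \<in> B" for n
    by (induction n) (auto intro: sub d)
  show "1 \<in> localization B d"
    using base_subset_localization sub(1) by blast
  fix f g assume "f \<in> localization B d" "g \<in> localization B d"
  then obtain b n c m where f: "f = b / d ^ n" "b \<in> B" and g: "g = c / d ^ m" "c \<in> B"
    by (auto simp: localization_def)
  have "f - g = (b * d ^ m - c * d ^ n) / d ^ (n + m)"
    using d by (simp add: f g field_simps power_add)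
  with f g pow show "f - g \<in> localization B d"
    unfolding localization_def by (blast intro: sub)
  have "f * g = (b * c) / d ^ (n + m)"
    by (simp add: f g power_add)
  with f g show "f * g \<in> localization B d"
    unfolding localization_def by (blast intro: sub)
qed

lemma inverse_in_localization:
  assumes "d = u * v" "v \<in> B" "d \<noteq> 0"
  shows "1 / u \<in> localization B d"
proof -
  have "1 / u = v / d ^ 1"
    using assms by auto
  with \<open>v \<in> B\<close> show ?thesis
    unfolding localization_def by blast
qed

lemma is_subring_polynomials: "is_subring (range (\<lambda>p. Fract p 1))"
  unfolding is_subring_def
proof (intro conjI ballI)
  show "1 \<in> range (\<lambda>p :: pol. Fract p 1)"
    by (auto simp: One_fract_def)
qed auto

lemma is_subring_polynomials_Y: "is_subring (range (\<lambda>p :: K poly poly. Fract [:[:p:]:] 1))"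
  unfolding is_subring_def
proof (intro conjI ballI)
  show "1 \<in> range (\<lambda>p :: K poly poly. Fract [:[:p:]:] 1 :: ratfun)"
    by (rule range_eqI[of _ _ 1]) (simp add: One_fract_def flip: one_pCons)
next
  fix f g assume "f \<in> range (\<lambda>p :: K poly poly. Fract [:[:p:]:] 1 :: ratfun)"
    "g \<in> range (\<lambda>p :: K poly poly. Fract [:[:p:]:] 1 :: ratfun)"
  then obtain p q where "f = Fract [:[:p:]:] 1" "g = Fract [:[:q:]:] 1"
    by blast
  then show "f - g \<in> range (\<lambda>p :: K poly poly. Fract [:[:p:]:] 1)"
    "f * g \<in> range (\<lambda>p :: K poly poly. Fract [:[:p:]:] 1)"
    by (auto intro: range_eqI[of _ _ "p - q"] range_eqI[of _ _ "p * q"])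
qed

abbreviation "poles_X \<equiv> s\<^sub>1 * s\<^sub>2 * Qs * Lsx * (x\<^sub>1 * x\<^sub>2 * Rx)"
abbreviation "poles_Y \<equiv> y\<^sub>1 * (1 - y\<^sub>1) * y\<^sub>2 * (1 - y\<^sub>2) * (1 - y\<^sub>1 - y\<^sub>2)"

lemma O_XX_eq: "O_XX = localization (range (\<lambda>p. Fract p 1)) poles_X"
  by (auto simp: O_XX_def localization_def)

lemma O_Y_eq: "O_Y = localization (range (\<lambda>p. Fract [:[:p:]:] 1)) poles_Y"
  by (auto simp: O_Y_def localization_def)

lemma coords_polynomial:
  "{s\<^sub>1, s\<^sub>2, x\<^sub>1, x\<^sub>2, cst c} \<subseteq> range (\<lambda>p. Fract p 1)"
  by (auto simp: s\<^sub>1_def s\<^sub>2_def x\<^sub>1_def x\<^sub>2_def cst_def)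

lemma coords_polynomial_Y:
  "{y\<^sub>1, y\<^sub>2, cst c} \<subseteq> range (\<lambda>p. Fract [:[:p:]:] 1)"
  by (auto simp: y\<^sub>1_def y\<^sub>2_def cst_def)

lemma Qs_polynomial: "Qs \<in> range (\<lambda>p. Fract p 1)"
  and Lsx_polynomial: "Lsx \<in> range (\<lambda>p. Fract p 1)"
  and Rx_polynomial: "Rx \<in> range (\<lambda>p. Fract p 1)"
proof -
  note sub = is_subringD[OF is_subring_polynomials] and c = coords_polynomial
  have "Rx = x\<^sub>1 * x\<^sub>1 + x\<^sub>2 * x\<^sub>2 - cst 2 * x\<^sub>1 * x\<^sub>2 - cst 2 * x\<^sub>1 - cst 2 * x\<^sub>2 + 1"
    by (simp add: Rx_def power2_eq_square cst_numeral)
  moreover have "\<dots> \<in> range (\<lambda>p. Fract p 1)"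
    using c by (intro sub) blast+
  ultimately show "Rx \<in> range (\<lambda>p. Fract p 1)"
    by simp
  show "Qs \<in> range (\<lambda>p. Fract p 1)" "Lsx \<in> range (\<lambda>p. Fract p 1)"
    unfolding Qs_def Lsx_def using c by (intro sub; blast)+
qed

lemma is_subring_O_XX: "is_subring O_XX"
  unfolding O_XX_eq using coords_polynomial
  by (intro is_subring_localization is_subring_polynomials is_subringD[OF is_subring_polynomials]
      Qs_polynomial Lsx_polynomial Rx_polynomial)
    (auto simp: s\<^sub>1_nz s\<^sub>2_nz Qs_nz Lsx_nz Rx_nz x\<^sub>1_nz x\<^sub>2_nz)

lemma is_subring_O_Y: "is_subring O_Y"
  unfolding O_Y_eq using coords_polynomial_Y
  by (intro is_subring_localization is_subring_polynomials_Y
      is_subringD[OF is_subring_polynomials_Y])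
    (auto simp: y_nz y_nz')

lemma O_XX_gens:
  "s\<^sub>1 \<in> O_XX" "s\<^sub>2 \<in> O_XX" "x\<^sub>1 \<in> O_XX" "x\<^sub>2 \<in> O_XX" "cst c \<in> O_XX"
  "1 / s\<^sub>1 \<in> O_XX" "1 / s\<^sub>2 \<in> O_XX" "1 / Qs \<in> O_XX" "1 / Lsx \<in> O_XX"
proof -
  note sub = is_subringD[OF is_subring_polynomials] and c = coords_polynomial
  show "s\<^sub>1 \<in> O_XX" "s\<^sub>2 \<in> O_XX" "x\<^sub>1 \<in> O_XX" "x\<^sub>2 \<in> O_XX" "cst c \<in> O_XX"
    unfolding O_XX_eq using c base_subset_localization by blast+
  have nz: "poles_X \<noteq> 0"
    by (simp add: s\<^sub>1_nz s\<^sub>2_nz Qs_nz Lsx_nz Rx_nz x\<^sub>1_nz x\<^sub>2_nz)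
  let ?P = "range (\<lambda>p :: pol. Fract p 1)"
  have P: "s\<^sub>1 \<in> ?P" "s\<^sub>2 \<in> ?P" "x\<^sub>1 * x\<^sub>2 * Rx \<in> ?P" "Qs \<in> ?P" "Lsx \<in> ?P"
    using c by (auto intro!: sub(6) Rx_polynomial Qs_polynomial Lsx_polynomial)
  show "1 / s\<^sub>1 \<in> O_XX"
    unfolding O_XX_eq
    by (rule inverse_in_localization[OF _ _ nz, where v = "s\<^sub>2 * Qs * Lsx * (x\<^sub>1 * x\<^sub>2 * Rx)"])
      (simp only: ac_simps, intro sub P)
  show "1 / s\<^sub>2 \<in> O_XX"
    unfolding O_XX_eq
    by (rule inverse_in_localization[OF _ _ nz, where v = "s\<^sub>1 * Qs * Lsx * (x\<^sub>1 * x\<^sub>2 * Rx)"])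
      (simp only: ac_simps, intro sub P)
  show "1 / Qs \<in> O_XX"
    unfolding O_XX_eq
    by (rule inverse_in_localization[OF _ _ nz, where v = "s\<^sub>1 * s\<^sub>2 * Lsx * (x\<^sub>1 * x\<^sub>2 * Rx)"])
      (simp only: ac_simps, intro sub P)
  show "1 / Lsx \<in> O_XX"
    unfolding O_XX_eq
    by (rule inverse_in_localization[OF _ _ nz, where v = "s\<^sub>1 * s\<^sub>2 * Qs * (x\<^sub>1 * x\<^sub>2 * Rx)"])
      (simp only: ac_simps, intro sub P)
qed

lemma O_Y_gens:
  "y\<^sub>1 \<in> O_Y" "y\<^sub>2 \<in> O_Y" "cst c \<in> O_Y" "1 / y\<^sub>1 \<in> O_Y" "1 / y\<^sub>2 \<in> O_Y"
  "1 / (1 - y\<^sub>1) \<in> O_Y" "1 / (1 - y\<^sub>2) \<in> O_Y" "1 / (1 - y\<^sub>1 - y\<^sub>2) \<in> O_Y"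
  "1 / (y\<^sub>1 - 1) \<in> O_Y" "1 / (y\<^sub>2 - 1) \<in> O_Y" "1 / (y\<^sub>1 + y\<^sub>2 - 1) \<in> O_Y"
proof -
  let ?P = "range (\<lambda>p :: K poly poly. Fract [:[:p:]:] 1 :: ratfun)"
  note sub = is_subringD[OF is_subring_polynomials_Y] and c = coords_polynomial_Y
  show "y\<^sub>1 \<in> O_Y" "y\<^sub>2 \<in> O_Y" "cst c \<in> O_Y"
    unfolding O_Y_eq using c base_subset_localization by blast+
  have P: "y\<^sub>1 \<in> ?P" "y\<^sub>2 \<in> ?P"
    using c by auto
  have nz: "poles_Y \<noteq> 0"
    by (simp add: y_nz y_nz')
  show "1 / y\<^sub>1 \<in> O_Y"
    unfolding O_Y_eq
    by (rule inverse_in_localization[OF _ _ nz,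
          where v = "(1 - y\<^sub>1) * y\<^sub>2 * (1 - y\<^sub>2) * (1 - y\<^sub>1 - y\<^sub>2)"])
      (simp only: ac_simps, intro sub P)
  show "1 / y\<^sub>2 \<in> O_Y"
    unfolding O_Y_eq
    by (rule inverse_in_localization[OF _ _ nz,
          where v = "y\<^sub>1 * (1 - y\<^sub>1) * (1 - y\<^sub>2) * (1 - y\<^sub>1 - y\<^sub>2)"])
      (simp only: ac_simps, intro sub P)
  show 1: "1 / (1 - y\<^sub>1) \<in> O_Y"
    unfolding O_Y_eq
    by (rule inverse_in_localization[OF _ _ nz,
          where v = "y\<^sub>1 * y\<^sub>2 * (1 - y\<^sub>2) * (1 - y\<^sub>1 - y\<^sub>2)"])
      (simp only: ac_simps, intro sub P)
  show 2: "1 / (1 - y\<^sub>2) \<in> O_Y"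
    unfolding O_Y_eq
    by (rule inverse_in_localization[OF _ _ nz,
          where v = "y\<^sub>1 * (1 - y\<^sub>1) * y\<^sub>2 * (1 - y\<^sub>1 - y\<^sub>2)"])
      (simp only: ac_simps, intro sub P)
  show 3: "1 / (1 - y\<^sub>1 - y\<^sub>2) \<in> O_Y"
    unfolding O_Y_eq
    by (rule inverse_in_localization[OF _ _ nz,
          where v = "y\<^sub>1 * (1 - y\<^sub>1) * y\<^sub>2 * (1 - y\<^sub>2)"])
      (simp only: ac_simps, intro sub P)
  have neg: "1 / (- u) \<in> O_Y" if "1 / u \<in> O_Y" for u
    using is_subringD(3)[OF is_subring_O_Y that] by simp
  show "1 / (y\<^sub>1 - 1) \<in> O_Y" "1 / (y\<^sub>2 - 1) \<in> O_Y" "1 / (y\<^sub>1 + y\<^sub>2 - 1) \<in> O_Y"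
    using neg[OF 1] neg[OF 2] neg[OF 3] by (simp_all add: algebra_simps)
qed

lemmas O_XX_intros = is_subringD[OF is_subring_O_XX] O_XX_gens
lemmas O_Y_intros = is_subringD[OF is_subring_O_Y] O_Y_gens

lemma O_XX_divide: "f \<in> O_XX \<Longrightarrow> 1 / g \<in> O_XX \<Longrightarrow> f / g \<in> O_XX"
  using is_subringD(6)[OF is_subring_O_XX, of f "1 / g"] by simp

lemma O_XX_inverse_mult: "1 / f \<in> O_XX \<Longrightarrow> 1 / g \<in> O_XX \<Longrightarrow> 1 / (f * g) \<in> O_XX"
  using is_subringD(6)[OF is_subring_O_XX, of "1 / f" "1 / g"] by simp

lemma O_Y_divide: "f \<in> O_Y \<Longrightarrow> 1 / g \<in> O_Y \<Longrightarrow> f / g \<in> O_Y"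
  using is_subringD(6)[OF is_subring_O_Y, of f "1 / g"] by simp

section \<open>Calculus of forms\<close>

text \<open>
  The single-term form \<open>f dz\<^sub>I\<close>, with \<open>I\<close> enumerated increasingly. All forms that occur are short
  sums of these, which turns the calculus of forms into rewriting.
\<close>

definition monoform :: "nat set \<Rightarrow> ratfun \<Rightarrow> form" where
  "monoform I f = (\<lambda>J. if J = I then f else 0)"

lemma monoform_0 [simp]: "monoform I 0 = 0"
  by (auto simp: monoform_def)

lemma monoform_add: "monoform I (f + g) = monoform I f + monoform I g"
  by (auto simp: monoform_def)

lemma monoform_add_add:
  "(monoform I a + monoform J b) + (monoform I a' + monoform J b') =
    monoform I (a + a') + monoform J (b + b')"
  by (auto simp: monoform_def)

lemma monoform_diff: "monoform I (f - g) = monoform I f - monoform I g"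
  by (auto simp: monoform_def)

lemma monoform_minus: "monoform I (- f) = - monoform I f"
  by (auto simp: monoform_def)

lemma monoform_sum: "(\<Sum>k\<in>A. monoform I (f k)) = monoform I (\<Sum>k\<in>A. f k)"
  by (induction A rule: infinite_finite_induct) (auto simp: monoform_add)

lemma scal_monoform: "c \<bullet>\<^sub>f monoform I f = monoform I (c * f)"
  by (auto simp: monoform_def scal_def)

lemma scal_add: "c \<bullet>\<^sub>f (\<alpha> + \<beta>) = c \<bullet>\<^sub>f \<alpha> + c \<bullet>\<^sub>f \<beta>"
  by (auto simp: scal_def algebra_simps)

lemma scal_scal: "c \<bullet>\<^sub>f d \<bullet>\<^sub>f \<alpha> = (c * d) \<bullet>\<^sub>f \<alpha>"
  by (auto simp: scal_def)

lemma scal_0_left [simp]: "0 \<bullet>\<^sub>f \<alpha> = 0" and scal_0_right [simp]: "c \<bullet>\<^sub>f 0 = 0"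
  by (auto simp: scal_def)

lemma dz_eq_monoform: "dz i = monoform {i} 1"
  by (auto simp: dz_def monoform_def)

lemma fn_eq_monoform: "fn f = monoform {} f"
  by (auto simp: fn_def monoform_def)

lemma wedge_add_left: "(\<alpha> + \<beta>) \<and>\<^sub>f \<gamma> = \<alpha> \<and>\<^sub>f \<gamma> + \<beta> \<and>\<^sub>f \<gamma>"
  by (auto simp: wedge_def algebra_simps sum.distrib)

lemma wedge_add_right: "\<alpha> \<and>\<^sub>f (\<beta> + \<gamma>) = \<alpha> \<and>\<^sub>f \<beta> + \<alpha> \<and>\<^sub>f \<gamma>"
  by (auto simp: wedge_def algebra_simps sum.distrib)

lemma wedge_0_left [simp]: "0 \<and>\<^sub>f \<beta> = 0"
  by (auto simp: wedge_def)

lemma wedge_0_right [simp]: "\<alpha> \<and>\<^sub>f 0 = 0"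
  by (auto simp: wedge_def)

text \<open>
  The sign picked up when \<open>dz\<^sub>i\<close> is moved from the front to its place in the increasing product of
  the \<open>dz\<^sub>j\<close>, \<open>j \<in> I\<close>.
\<close>

definition pos_sign :: "nat \<Rightarrow> nat set \<Rightarrow> ratfun" where
  "pos_sign i I = (- 1) ^ card {j \<in> I. j < i}"

lemma pos_sign_0 [simp]: "pos_sign 0 I = 1"
  by (simp add: pos_sign_def)

lemma pos_sign_Suc: "pos_sign (Suc i) I = (if i \<in> I then - pos_sign i I else pos_sign i I)"
proof -
  have "{j \<in> I. j < Suc i} = (if i \<in> I then insert i {j \<in> I. j < i} else {j \<in> I. j < i})"
    by (auto simp: less_Suc_eq)
  moreover have "finite {j \<in> I. j < i}"
    by (rule finite_subset[of _ "{..<i}"]) auto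
  ultimately show ?thesis
    by (simp add: pos_sign_def)
qed

lemma pos_sign_numeral:
  "pos_sign (numeral k) I =
     (if pred_numeral k \<in> I then - pos_sign (pred_numeral k) I else pos_sign (pred_numeral k) I)"
  by (simp add: numeral_eq_Suc pos_sign_Suc)

text \<open>
  Only \<open>J = {i}\<close> contributes to the sum over the splittings of \<open>I\<close>. On infinite \<open>I\<close> that sum is \<open>0\<close>
  by convention.
\<close>

lemma wedge_monoform_left_apply:
  "(monoform {i} f \<and>\<^sub>f \<beta>) I =
     (if finite I \<and> i \<in> I then pos_sign i I * f * \<beta> (I - {i}) else 0)"
proof (cases "finite I \<and> i \<in> I")
  case True
  have "{(j, j'). (j, j') \<in> {i} \<times> (I - {i}) \<and> j' < j} = Pair i ` {j \<in> I. j < i}"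
    by auto
  then have "shuffle_sign {i} (I - {i}) = pos_sign i I"
    by (simp add: shuffle_sign_def pos_sign_def card_image inj_on_def split_def)
  have "(monoform {i} f \<and>\<^sub>f \<beta>) I = (\<Sum>J\<in>{{i}}. shuffle_sign J (I - J) * monoform {i} f J * \<beta> (I - J))"
    unfolding wedge_def using True by (intro sum.mono_neutral_right) (auto simp: monoform_def)
  with True \<open>shuffle_sign {i} (I - {i}) = pos_sign i I\<close> show ?thesis
    by (simp add: monoform_def)
next
  case False
  then have "finite (Pow I) \<longrightarrow> {i} \<notin> Pow I"
    by (auto simp: finite_Pow_iff)
  then have "(monoform {i} f \<and>\<^sub>f \<beta>) I = 0"
    unfolding wedge_def
    by (cases "finite (Pow I)") (auto intro!: sum.neutral simp: monoform_def)
  then show ?thesis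
    by (simp only: if_not_P[OF False])
qed

lemma wedge_monoform:
  assumes "finite I"
  shows "monoform {i} f \<and>\<^sub>f monoform I g =
    (if i \<in> I then 0 else monoform (insert i I) (pos_sign i I * f * g))"
proof
  fix J
  have "{j \<in> insert i I. j < i} = {j \<in> I. j < i}"
    by auto
  then have "pos_sign i (insert i I) = pos_sign i I"
    by (simp add: pos_sign_def)
  moreover have "finite J \<and> i \<in> J \<and> J - {i} = I \<longleftrightarrow> i \<notin> I \<and> J = insert i I"
    using assms by auto
  moreover have "(monoform {i} f \<and>\<^sub>f monoform I g) J =
      (if finite J \<and> i \<in> J \<and> J - {i} = I then pos_sign i J * f * g else 0)"
    by (simp add: wedge_monoform_left_apply monoform_def[of I])
  ultimately show "(monoform {i} f \<and>\<^sub>f monoform I g) J =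
    (if i \<in> I then 0 else monoform (insert i I) (pos_sign i I * f * g)) J"
    by (simp add: monoform_def)
qed

lemma wedge_minus_left: "(- \<alpha>) \<and>\<^sub>f \<beta> = - (\<alpha> \<and>\<^sub>f \<beta>)"
  by (auto simp: wedge_def sum_negf)

lemma wedge_diff_left: "(\<alpha> - \<beta>) \<and>\<^sub>f \<gamma> = \<alpha> \<and>\<^sub>f \<gamma> - \<beta> \<and>\<^sub>f \<gamma>"
  by (auto simp: wedge_def sum_subtractf algebra_simps)

lemma ext_d_add: "ext_d V (\<alpha> + \<beta>) = ext_d V \<alpha> + ext_d V \<beta>"
proof -
  have "(\<lambda>I. pd i ((\<alpha> + \<beta>) I)) = (\<lambda>I. pd i (\<alpha> I)) + (\<lambda>I. pd i (\<beta> I))" for i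
    by (auto simp: pd_add)
  then show ?thesis
    by (simp add: ext_d_def wedge_add_right sum.distrib)
qed

lemma ext_d_monoform: "ext_d V (monoform I f) = (\<Sum>i\<in>V. monoform {i} 1 \<and>\<^sub>f monoform I (pd i f))"
proof -
  have "(\<lambda>J. pd i (monoform I f J)) = monoform I (pd i f)" for i
    by (auto simp: monoform_def)
  then show ?thesis
    by (simp add: ext_d_def dz_eq_monoform)
qed

lemma ext_d_0 [simp]: "ext_d V 0 = 0"
  using ext_d_add[of V 0 0] by simp

text \<open>
  A wedge product inserts the new index in front; these equations restore the increasing enumeration,
  by which index sets are recognised as equal.
\<close>

lemma insert_sort:
  "insert (Suc 0) {0} = {0, Suc 0 :: nat}" "insert 2 {0, Suc 0 :: nat} = {0, Suc 0, 2}"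
  "insert 3 {0, Suc 0 :: nat} = {0, Suc 0, 3}"  "insert 3 {2 :: nat} = {2, 3}"
  by auto

lemmas form_simps = wedge_monoform wedge_add_left wedge_add_right wedge_diff_left wedge_minus_left
  pos_sign_Suc pos_sign_numeral scal_add scal_monoform insert_sort

section \<open>Pull-back of forms\<close>

lemma pr_dz_simps:
  "pr_dz 0 = monoform {0} 1" "pr_dz (Suc 0) = monoform {Suc 0} 1"
  "pr_dz 2 = monoform {2} (1 - y\<^sub>2) + monoform {3} (- y\<^sub>1)"
  "pr_dz 3 = monoform {2} (- y\<^sub>2) + monoform {3} (1 - y\<^sub>1)"
proof -
  have pr: "pr_fun s\<^sub>1 = s\<^sub>1" "pr_fun s\<^sub>2 = s\<^sub>2" "pr_fun x\<^sub>1 = pr_x\<^sub>1" "pr_fun x\<^sub>2 = pr_x\<^sub>2"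
    by (rule pr_fun_eqI, rule has_pullback_intros)+
  show "pr_dz 0 = monoform {0} 1" "pr_dz (Suc 0) = monoform {Suc 0} 1"
    "pr_dz 2 = monoform {2} (1 - y\<^sub>2) + monoform {3} (- y\<^sub>1)"
    "pr_dz 3 = monoform {2} (- y\<^sub>2) + monoform {3} (1 - y\<^sub>1)"
    by (simp_all add: pr_dz_def pr fn_eq_monoform ext_d_monoform wedge_monoform pd_simps
        pos_sign_Suc pos_sign_numeral)
qed

lemma pr_form_monoform:
  assumes "I \<subseteq> {0, 1, 2, 3}"
  shows "pr_form (monoform I f) =
    pr_fun f \<bullet>\<^sub>f foldr wedge (map pr_dz (sorted_list_of_set I)) (fn 1)"
proof -
  have "pr_form (monoform I f) =
    (\<Sum>J\<in>{I}. pr_fun (monoform I f J) \<bullet>\<^sub>f foldr wedge (map pr_dz (sorted_list_of_set J)) (fn 1))"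
    unfolding pr_form_def using assms
    by (intro sum.mono_neutral_right) (auto simp: monoform_def)
  then show ?thesis
    by (simp add: monoform_def)
qed

text \<open>
  Additivity of \<open>pr_form\<close> on forms without common terms follows from \<open>pr_fun 0 = 0\<close> alone, so the
  coefficients may be arbitrary rational functions, even ones to which \<open>pr\<close> does not extend.
\<close>

lemma pr_form_add_disjoint:
  assumes "\<And>I. \<alpha> I = 0 \<or> \<beta> I = 0"
  shows "pr_form (\<alpha> + \<beta>) = pr_form \<alpha> + pr_form \<beta>"
proof -
  have "pr_fun ((\<alpha> + \<beta>) I) = pr_fun (\<alpha> I) + pr_fun (\<beta> I)" for I
    using assms[of I] by auto
  moreover have "(f + g) \<bullet>\<^sub>f \<gamma> = f \<bullet>\<^sub>f \<gamma> + g \<bullet>\<^sub>f \<gamma>" for f g \<gamma>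
    by (auto simp: scal_def algebra_simps)
  ultimately show ?thesis
    by (simp add: pr_form_def sum.distrib)
qed

lemma pr_form_simps:
  "pr_form (monoform {0, Suc 0} f) = monoform {0, Suc 0} (pr_fun f)"
  "pr_form (monoform {2} f) = monoform {2} ((1 - y\<^sub>2) * pr_fun f) + monoform {3} (- y\<^sub>1 * pr_fun f)"
  "pr_form (monoform {3} f) = monoform {2} (- y\<^sub>2 * pr_fun f) + monoform {3} ((1 - y\<^sub>1) * pr_fun f)"
  "pr_form (monoform {0, Suc 0, 2} f) =
     monoform {0, Suc 0, 2} ((1 - y\<^sub>2) * pr_fun f) + monoform {0, Suc 0, 3} (- y\<^sub>1 * pr_fun f)"
  "pr_form (monoform {0, Suc 0, 3} f) =
     monoform {0, Suc 0, 2} (- y\<^sub>2 * pr_fun f) + monoform {0, Suc 0, 3} ((1 - y\<^sub>1) * pr_fun f)"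
  by (simp_all add: pr_form_monoform pr_dz_simps fn_eq_monoform form_simps mult_ac)

section \<open>Spans of pulled-back forms\<close>

lemma pr_moduleI: "f \<in> O_Y \<Longrightarrow> \<eta> \<in> N \<Longrightarrow> f \<bullet>\<^sub>f pr_form \<eta> \<in> pr_module N"
  unfolding pr_module_def
  by (intro CollectI exI[of _ 1] exI[of _ "\<lambda>_. f"] exI[of _ "\<lambda>_. \<eta>"]) simp

lemma pr_form_in_pr_module: "\<eta> \<in> N \<Longrightarrow> pr_form \<eta> \<in> pr_module N"
  using pr_moduleI[OF O_Y_intros(1), of \<eta> N] by (simp add: scal_def)

lemma pr_module_0: "0 \<in> pr_module N"
  unfolding pr_module_def by (intro CollectI exI[of _ 0]) simp

lemma pr_module_add:
  assumes "\<alpha> \<in> pr_module N" "\<beta> \<in> pr_module N"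
  shows "\<alpha> + \<beta> \<in> pr_module N"
proof -
  obtain n f \<eta> where \<alpha>: "\<alpha> = (\<Sum>k<(n :: nat). f k \<bullet>\<^sub>f pr_form (\<eta> k))"
    and 1: "\<forall>k<n. f k \<in> O_Y \<and> \<eta> k \<in> N"
    using assms unfolding pr_module_def by blast
  obtain m g \<theta> where \<beta>: "\<beta> = (\<Sum>k<(m :: nat). g k \<bullet>\<^sub>f pr_form (\<theta> k))"
    and 2: "\<forall>k<m. g k \<in> O_Y \<and> \<theta> k \<in> N"
    using assms unfolding pr_module_def by blast
  let ?h = "\<lambda>k. if k < n then f k else g (k - n)" and ?\<zeta> = "\<lambda>k. if k < n then \<eta> k else \<theta> (k - n)"
  have "(\<Sum>k<n + m. ?h k \<bullet>\<^sub>f pr_form (?\<zeta> k)) = \<alpha> + \<beta>"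
  proof -
    have "{..<n + m} = {..<n} \<union> {n..<n + m}" "{..<n} \<inter> {n..<n + m} = {}"
      by auto
    moreover have "(\<Sum>k\<in>{n..<n + m}. ?h k \<bullet>\<^sub>f pr_form (?\<zeta> k)) = \<beta>"
      unfolding \<beta> by (rule sum.reindex_bij_witness[of _ "\<lambda>k. k + n" "\<lambda>k. k - n"]) auto
    ultimately show ?thesis
      by (simp add: sum.union_disjoint \<alpha>)
  qed
  moreover have "\<forall>k<n + m. ?h k \<in> O_Y \<and> ?\<zeta> k \<in> N"
    using 1 2 by auto
  ultimately show ?thesis
    unfolding pr_module_def by (intro CollectI exI[of _ "n + m"] exI[of _ ?h] exI[of _ ?\<zeta>]) simp
qed

lemma pr_module_scal:
  assumes "c \<in> O_Y" "\<alpha> \<in> pr_module N"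
  shows "c \<bullet>\<^sub>f \<alpha> \<in> pr_module N"
proof -
  obtain n f \<eta> where \<alpha>: "\<alpha> = (\<Sum>k<(n :: nat). f k \<bullet>\<^sub>f pr_form (\<eta> k))"
    and 1: "\<forall>k<n. f k \<in> O_Y \<and> \<eta> k \<in> N"
    using assms unfolding pr_module_def by blast
  have "c \<bullet>\<^sub>f \<alpha> = (\<Sum>k<n. (c * f k) \<bullet>\<^sub>f pr_form (\<eta> k))"
    unfolding \<alpha> by (induction n) (simp_all only: lessThan_0 sum.empty
        sum.lessThan_Suc scal_0_right scal_add scal_scal)
  moreover have "\<forall>k<n. c * f k \<in> O_Y \<and> \<eta> k \<in> N"
    using 1 assms(1) by (auto intro: O_Y_intros)
  ultimately show ?thesis
    unfolding pr_module_def by (intro CollectI exI[of _ n] exI[of _ "\<lambda>k. c * f k"] exI[of _ \<eta>]) simp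
qed

lemma pr_module_minus: "\<alpha> \<in> pr_module N \<Longrightarrow> - \<alpha> \<in> pr_module N"
  using pr_module_scal[of "- 1" \<alpha> N] by (simp add: O_Y_intros scal_def fun_Compl_def)

lemma pr_module_diff: "\<alpha> \<in> pr_module N \<Longrightarrow> \<beta> \<in> pr_module N \<Longrightarrow> \<alpha> - \<beta> \<in> pr_module N"
  using pr_module_add[of \<alpha> N "- \<beta>"] pr_module_minus[of \<beta> N] by simp

lemma pr_module_induct [consumes 1, case_names zero add scal]:
  assumes "u \<in> pr_module N" "P 0" "\<And>\<alpha> \<beta>. P \<alpha> \<Longrightarrow> P \<beta> \<Longrightarrow> P (\<alpha> + \<beta>)"
    "\<And>f \<eta>. f \<in> O_Y \<Longrightarrow> \<eta> \<in> N \<Longrightarrow> P (f \<bullet>\<^sub>f pr_form \<eta>)"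
  shows "P u"
proof -
  obtain n f \<eta> where u: "u = (\<Sum>k<(n :: nat). f k \<bullet>\<^sub>f pr_form (\<eta> k))"
    and 1: "\<forall>k<n. f k \<in> O_Y \<and> \<eta> k \<in> N"
    using assms(1) unfolding pr_module_def by blast
  from 1 show ?thesis
    unfolding u by (induction n) (auto intro: assms)
qed

text \<open>
  Since \<open>pr\<close> is unramified, \<open>dy\<^sub>1\<close> and \<open>dy\<^sub>2\<close> are \<open>O(Y)\<close>-combinations of \<open>pr\<^sup>*dx\<^sub>1\<close> and \<open>pr\<^sup>*dx\<^sub>2\<close>: the
  Jacobian determinant of \<open>pr\<close> is \<open>1 - y\<^sub>1 - y\<^sub>2\<close>, a unit of \<open>O(Y)\<close>.
\<close>

lemma pr_module_dy:
  assumes "\<And>m. m \<in> {2, 3} \<Longrightarrow> monoform {0, Suc 0, m} f \<in> N" and "has_pullback f g" and l: "l \<in> {2, 3}"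
  shows "monoform {0, Suc 0, l} g \<in> pr_module N"
proof -
  let ?\<delta> = "1 - y\<^sub>1 - y\<^sub>2"
  have g: "pr_fun f = g"
    using assms(2) by (rule pr_fun_eqI)
  have mem: "pr_form (monoform {0, Suc 0, 2} f) \<in> pr_module N"
    "pr_form (monoform {0, Suc 0, 3} f) \<in> pr_module N"
    by (auto intro: pr_form_in_pr_module assms)
  have 1: "g = (1 - y\<^sub>1) / ?\<delta> * ((1 - y\<^sub>2) * g) + y\<^sub>1 / ?\<delta> * (- y\<^sub>2 * g)"
    using y_nz(7) by (simp add: divide_simps) (simp add: algebra_simps)
  have 4: "g = y\<^sub>2 / ?\<delta> * (- y\<^sub>1 * g) + (1 - y\<^sub>2) / ?\<delta> * ((1 - y\<^sub>1) * g)"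
    using y_nz(7) by (simp add: divide_simps) (simp add: algebra_simps)
  have 2: "0 = (1 - y\<^sub>1) / ?\<delta> * (- y\<^sub>1 * g) + y\<^sub>1 / ?\<delta> * ((1 - y\<^sub>1) * g)"
    and 3: "0 = y\<^sub>2 / ?\<delta> * ((1 - y\<^sub>2) * g) + (1 - y\<^sub>2) / ?\<delta> * (- y\<^sub>2 * g)"
    by simp_all
  \<comment> \<open>the four entries of the product of the Jacobian matrix with its inverse, times \<open>g\<close>\<close>
  note coeffs = 1[symmetric] 2[symmetric] 3[symmetric] 4[symmetric]
  have eq2: "monoform {0, Suc 0, 2} g =
      ((1 - y\<^sub>1) / ?\<delta>) \<bullet>\<^sub>f pr_form (monoform {0, Suc 0, 2} f)
      + (y\<^sub>1 / ?\<delta>) \<bullet>\<^sub>f pr_form (monoform {0, Suc 0, 3} f)"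
    by (simp only: pr_form_simps g scal_add scal_monoform monoform_add_add coeffs monoform_0
        add_0_right)
  have eq3: "monoform {0, Suc 0, 3} g =
      (y\<^sub>2 / ?\<delta>) \<bullet>\<^sub>f pr_form (monoform {0, Suc 0, 2} f)
      + ((1 - y\<^sub>2) / ?\<delta>) \<bullet>\<^sub>f pr_form (monoform {0, Suc 0, 3} f)"
    by (simp only: pr_form_simps g scal_add scal_monoform monoform_add_add coeffs monoform_0
        add_0_left)
  have cs: "(1 - y\<^sub>1) / ?\<delta> \<in> O_Y" "y\<^sub>1 / ?\<delta> \<in> O_Y"
    "y\<^sub>2 / ?\<delta> \<in> O_Y" "(1 - y\<^sub>2) / ?\<delta> \<in> O_Y"
    by (rule O_Y_divide; intro O_Y_intros)+
  have "monoform {0, Suc 0, 2} g \<in> pr_module N"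
    unfolding eq2 by (intro pr_module_add pr_module_scal mem cs)
  moreover have "monoform {0, Suc 0, 3} g \<in> pr_module N"
    unfolding eq3 by (intro pr_module_add pr_module_scal mem cs)
  ultimately show ?thesis
    using l by auto
qed

section \<open>Twisted divergences\<close>

abbreviation \<mu>\<^sub>1 :: ratfun where "\<mu>\<^sub>1 \<equiv> cst lam\<^sub>1"
abbreviation \<mu>\<^sub>2 :: ratfun where "\<mu>\<^sub>2 \<equiv> cst lam\<^sub>2"
abbreviation \<mu>\<^sub>3 :: ratfun where "\<mu>\<^sub>3 \<equiv> cst lam\<^sub>3"
abbreviation \<mu>\<^sub>4 :: ratfun where "\<mu>\<^sub>4 \<equiv> cst lam\<^sub>4"

text \<open>
  The coefficients of \<open>ds\<^sub>1\<close> and \<open>ds\<^sub>2\<close> in \<open>\<omega>\<close>, that is, the logarithmic derivatives of \<open>U\<close>.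
\<close>

definition dlog\<^sub>1 :: ratfun where "dlog\<^sub>1 = \<mu>\<^sub>1 / s\<^sub>1 + \<mu>\<^sub>3 * (s\<^sub>2 - 1) / Qs - \<mu>\<^sub>4 * x\<^sub>1 / Lsx"
definition dlog\<^sub>2 :: ratfun where "dlog\<^sub>2 = \<mu>\<^sub>2 / s\<^sub>2 + \<mu>\<^sub>3 * (s\<^sub>1 - 1) / Qs - \<mu>\<^sub>4 * x\<^sub>2 / Lsx"

lemma pd_Qs: "pd 0 Qs = s\<^sub>2 - 1" "pd (Suc 0) Qs = s\<^sub>1 - 1"
  by (simp_all add: Qs_def pd_simps)

lemma pd_Lsx: "pd 0 Lsx = - x\<^sub>1" "pd (Suc 0) Lsx = - x\<^sub>2"
  by (simp_all add: Lsx_def pd_simps)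

lemma omega_eq: "omega = monoform {0} dlog\<^sub>1 + monoform {Suc 0} dlog\<^sub>2"
proof -
  have "omega =
     monoform {0} (\<mu>\<^sub>1 / s\<^sub>1 + \<mu>\<^sub>3 / Qs * (s\<^sub>2 - 1) + \<mu>\<^sub>4 / Lsx * (- x\<^sub>1))
     + monoform {Suc 0} (\<mu>\<^sub>2 / s\<^sub>2 + \<mu>\<^sub>3 / Qs * (s\<^sub>1 - 1) + \<mu>\<^sub>4 / Lsx * (- x\<^sub>2))"
    by (simp add: omega_def ds\<^sub>1_def ds\<^sub>2_def d_s_def fn_eq_monoform ext_d_monoform dz_eq_monoform
        form_simps pd_Qs pd_Lsx) (auto simp: monoform_def fun_eq_iff)
  then show ?thesis
    by (simp add: dlog\<^sub>1_def dlog\<^sub>2_def)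
qed

text \<open>
  \<open>U\<inverse> (\<partial>(U g\<^sub>1)/\<partial>s\<^sub>1 + \<partial>(U g\<^sub>2)/\<partial>s\<^sub>2)\<close>: the divergence of the vector field \<open>(g\<^sub>1, g\<^sub>2)\<close> in \<open>s\<close>, twisted
  by \<open>U\<close>.
\<close>

definition twisted_div :: "ratfun \<Rightarrow> ratfun \<Rightarrow> ratfun" where
  "twisted_div g\<^sub>1 g\<^sub>2 = pd 0 g\<^sub>1 + dlog\<^sub>1 * g\<^sub>1 + (pd (Suc 0) g\<^sub>2 + dlog\<^sub>2 * g\<^sub>2)"

lemma nabla_twisted_div:
  "nabla (monoform {Suc 0} g\<^sub>1 + monoform {0} (- g\<^sub>2)) = monoform {0, Suc 0} (twisted_div g\<^sub>1 g\<^sub>2)"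
  "nabla (monoform {Suc 0, 2} g\<^sub>1 + monoform {0, 2} (- g\<^sub>2)) =
    monoform {0, Suc 0, 2} (twisted_div g\<^sub>1 g\<^sub>2)"
  "nabla (monoform {Suc 0, 3} g\<^sub>1 + monoform {0, 3} (- g\<^sub>2)) =
    monoform {0, Suc 0, 3} (twisted_div g\<^sub>1 g\<^sub>2)"
  by (simp_all add: nabla_def d_s_def ext_d_add ext_d_monoform omega_eq form_simps twisted_div_def
      pd_minus) (auto simp: monoform_def fun_eq_iff insert_commute)

lemma forms_over_monoform:
  assumes "f \<in> A" "0 \<in> A" "I \<subseteq> {0, 1, 2, 3}" "card (I \<inter> {0, 1}) = i" "card (I \<inter> {2, 3}) = j"
  shows "monoform I f \<in> forms_over A i j"
  using assms by (auto simp: forms_over_def monoform_def)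

lemma forms_over_add:
  assumes "is_subring A" "\<alpha> \<in> forms_over A i j" "\<beta> \<in> forms_over A i j"
  shows "\<alpha> + \<beta> \<in> forms_over A i j"
proof -
  have "(\<alpha> + \<beta>) I \<in> A" for I
    using assms is_subringD(4)[OF assms(1)] by (auto simp: forms_over_def)
  moreover have "\<alpha> I \<noteq> 0 \<or> \<beta> I \<noteq> 0" if "(\<alpha> + \<beta>) I \<noteq> 0" for I
    using that by auto
  ultimately show ?thesis
    using assms(2,3) unfolding forms_over_def by blast
qed

text \<open>
  The submodule of functions \<open>f\<close> for which \<open>f ds\<^sub>1\<^sub>2 \<and> dy\<^sub>1\<close> (for \<open>l = 2\<close>) or \<open>f ds\<^sub>1\<^sub>2 \<and> dy\<^sub>2\<close>
  (for \<open>l = 3\<close>) lies in the span of \<open>pr\<^sup>*N\<close>. Working with it replaces congruences between forms by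
  congruences between functions.
\<close>

definition coeff_module :: "form set \<Rightarrow> nat \<Rightarrow> ratfun set" where
  "coeff_module N l = {f. monoform {0, Suc 0, l} f \<in> pr_module N}"

lemma coeff_module_add: "f \<in> coeff_module N l \<Longrightarrow> g \<in> coeff_module N l \<Longrightarrow> f + g \<in> coeff_module N l"
  by (auto simp: coeff_module_def monoform_add intro: pr_module_add)

lemma coeff_module_diff: "f \<in> coeff_module N l \<Longrightarrow> g \<in> coeff_module N l \<Longrightarrow> f - g \<in> coeff_module N l"
  by (auto simp: coeff_module_def monoform_diff intro: pr_module_diff)

lemma coeff_module_mult: "c \<in> O_Y \<Longrightarrow> f \<in> coeff_module N l \<Longrightarrow> c * f \<in> coeff_module N l"
  using pr_module_scal by (fastforce simp: coeff_module_def simp flip: scal_monoform)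

lemma coeff_module_0: "0 \<in> coeff_module N l"
  by (simp add: coeff_module_def pr_module_0)

abbreviation exact :: "nat \<Rightarrow> ratfun set" where
  "exact \<equiv> coeff_module (nabla ` Omega 1 1)"

lemma twisted_div_exact:
  assumes g: "g\<^sub>1 \<in> O_XX" "g\<^sub>2 \<in> O_XX" and v: "has_pullback (twisted_div g\<^sub>1 g\<^sub>2) v" and l: "l \<in> {2, 3}"
  shows "v \<in> exact l"
proof -
  have "monoform {0, Suc 0, m} (twisted_div g\<^sub>1 g\<^sub>2) \<in> nabla ` Omega 1 1" if "m \<in> {2, 3}" for m
  proof (rule image_eqI)
    show "monoform {0, Suc 0, m} (twisted_div g\<^sub>1 g\<^sub>2) =
        nabla (monoform {Suc 0, m} g\<^sub>1 + monoform {0, m} (- g\<^sub>2))"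
      using that by (auto simp: nabla_twisted_div)
    show "monoform {Suc 0, m} g\<^sub>1 + monoform {0, m} (- g\<^sub>2) \<in> Omega 1 1"
      unfolding Omega_def using that g
      by (intro forms_over_add forms_over_monoform is_subring_O_XX O_XX_intros) auto
  qed
  then show ?thesis
    unfolding coeff_module_def using pr_module_dy[OF _ v l] by blast
qed

section \<open>Integration-by-parts relations over \<open>X\<close>\<close>

text \<open>
  Each function below takes the two coordinates as arguments: at \<open>(x\<^sub>1, x\<^sub>2)\<close> it is a function on
  \<open>\<XX>\<close>, at \<open>(pr_x\<^sub>1, pr_x\<^sub>2)\<close> its pull-back. \<open>lin\<close> is \<open>L\<close>, the \<open>F\<^sub>i\<close> are the coefficients of the
  \<open>\<phi>\<^sub>i\<close>, the \<open>G\<^sub>i\<close> are auxiliary, and \<open>N\<^sub>i\<^sub>k\<close> is the coefficient of the derivative of \<open>\<phi>\<^sub>i\<close> along \<open>x\<^sub>k\<close>,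
  \<open>\<partial>F\<^sub>i/\<partial>x\<^sub>k - \<lambda>\<^sub>4 s\<^sub>k F\<^sub>i / L\<close>. The two mixed ones are multiples of one function \<open>H\<^sub>0\<close>: along \<open>x\<^sub>2\<close>, \<open>\<phi>\<^sub>2\<close>
  has derivative \<open>x\<^sub>1 H\<^sub>0\<close>, and along \<open>x\<^sub>1\<close>, \<open>\<phi>\<^sub>3\<close> has derivative \<open>x\<^sub>2 H\<^sub>0\<close>.
\<close>

definition lin :: "ratfun \<Rightarrow> ratfun \<Rightarrow> ratfun" where "lin x x' = 1 - s\<^sub>1 * x - s\<^sub>2 * x'"

definition F\<^sub>1 :: "ratfun \<Rightarrow> ratfun \<Rightarrow> ratfun" where "F\<^sub>1 x x' = 1 / (s\<^sub>1 * s\<^sub>2)"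
definition F\<^sub>2 :: "ratfun \<Rightarrow> ratfun \<Rightarrow> ratfun" where "F\<^sub>2 x x' = x / (s\<^sub>2 * lin x x')"
definition F\<^sub>3 :: "ratfun \<Rightarrow> ratfun \<Rightarrow> ratfun" where "F\<^sub>3 x x' = x' / (s\<^sub>1 * lin x x')"
definition F\<^sub>4 :: "ratfun \<Rightarrow> ratfun \<Rightarrow> ratfun" where "F\<^sub>4 x x' = 1 / (Qs * lin x x')"
definition G\<^sub>1 :: "ratfun \<Rightarrow> ratfun \<Rightarrow> ratfun" where "G\<^sub>1 x x' = s\<^sub>1 / (Qs * lin x x')"
definition G\<^sub>2 :: "ratfun \<Rightarrow> ratfun \<Rightarrow> ratfun" where "G\<^sub>2 x x' = s\<^sub>2 / (Qs * lin x x')"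
definition N\<^sub>2\<^sub>1 :: "ratfun \<Rightarrow> ratfun \<Rightarrow> ratfun" where
  "N\<^sub>2\<^sub>1 x x' = 1 / (s\<^sub>2 * lin x x') + (1 - \<mu>\<^sub>4) * s\<^sub>1 * x / (s\<^sub>2 * (lin x x' * lin x x'))"
definition N\<^sub>3\<^sub>2 :: "ratfun \<Rightarrow> ratfun \<Rightarrow> ratfun" where
  "N\<^sub>3\<^sub>2 x x' = 1 / (s\<^sub>1 * lin x x') + (1 - \<mu>\<^sub>4) * s\<^sub>2 * x' / (s\<^sub>1 * (lin x x' * lin x x'))"
definition H\<^sub>0 :: "ratfun \<Rightarrow> ratfun \<Rightarrow> ratfun" where
  "H\<^sub>0 x x' = (1 - \<mu>\<^sub>4) / (lin x x' * lin x x')"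
definition N\<^sub>4\<^sub>1 :: "ratfun \<Rightarrow> ratfun \<Rightarrow> ratfun" where
  "N\<^sub>4\<^sub>1 x x' = (1 - \<mu>\<^sub>4) * s\<^sub>1 / (Qs * (lin x x' * lin x x'))"
definition N\<^sub>4\<^sub>2 :: "ratfun \<Rightarrow> ratfun \<Rightarrow> ratfun" where
  "N\<^sub>4\<^sub>2 x x' = (1 - \<mu>\<^sub>4) * s\<^sub>2 / (Qs * (lin x x' * lin x x'))"

lemmas coeff_defs = F\<^sub>1_def F\<^sub>2_def F\<^sub>3_def F\<^sub>4_def G\<^sub>1_def G\<^sub>2_def N\<^sub>2\<^sub>1_def N\<^sub>3\<^sub>2_def H\<^sub>0_def N\<^sub>4\<^sub>1_def N\<^sub>4\<^sub>2_def

lemma lin_x: "lin x\<^sub>1 x\<^sub>2 = Lsx"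
  by (simp add: lin_def Lsx_def)

lemma lin_y_nz: "lin pr_x\<^sub>1 pr_x\<^sub>2 \<noteq> 0"
proof (rule nonzero_if_pd[of 0], rule nonzero_if_pd[of 2], rule nonzero_if_pd[of 3])
  show "pd 3 (pd 2 (pd 0 (lin pr_x\<^sub>1 pr_x\<^sub>2))) \<noteq> 0"
    by (simp add: lin_def pd_simps)
qed

lemma has_pullback_lin: "has_pullback (lin x\<^sub>1 x\<^sub>2) (lin pr_x\<^sub>1 pr_x\<^sub>2)"
  unfolding lin_def by (intro has_pullback_intros)

lemma has_pullback_Qs: "has_pullback Qs Qs"
  unfolding Qs_def by (intro has_pullback_intros)

lemma has_pullback_coeffs:
  "has_pullback (F\<^sub>1 x\<^sub>1 x\<^sub>2) (F\<^sub>1 pr_x\<^sub>1 pr_x\<^sub>2)" "has_pullback (F\<^sub>2 x\<^sub>1 x\<^sub>2) (F\<^sub>2 pr_x\<^sub>1 pr_x\<^sub>2)"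
  "has_pullback (F\<^sub>3 x\<^sub>1 x\<^sub>2) (F\<^sub>3 pr_x\<^sub>1 pr_x\<^sub>2)" "has_pullback (F\<^sub>4 x\<^sub>1 x\<^sub>2) (F\<^sub>4 pr_x\<^sub>1 pr_x\<^sub>2)"
  "has_pullback (G\<^sub>1 x\<^sub>1 x\<^sub>2) (G\<^sub>1 pr_x\<^sub>1 pr_x\<^sub>2)" "has_pullback (G\<^sub>2 x\<^sub>1 x\<^sub>2) (G\<^sub>2 pr_x\<^sub>1 pr_x\<^sub>2)"
  "has_pullback (N\<^sub>2\<^sub>1 x\<^sub>1 x\<^sub>2) (N\<^sub>2\<^sub>1 pr_x\<^sub>1 pr_x\<^sub>2)" "has_pullback (N\<^sub>3\<^sub>2 x\<^sub>1 x\<^sub>2) (N\<^sub>3\<^sub>2 pr_x\<^sub>1 pr_x\<^sub>2)"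
  "has_pullback (H\<^sub>0 x\<^sub>1 x\<^sub>2) (H\<^sub>0 pr_x\<^sub>1 pr_x\<^sub>2)"
  "has_pullback (N\<^sub>4\<^sub>1 x\<^sub>1 x\<^sub>2) (N\<^sub>4\<^sub>1 pr_x\<^sub>1 pr_x\<^sub>2)" "has_pullback (N\<^sub>4\<^sub>2 x\<^sub>1 x\<^sub>2) (N\<^sub>4\<^sub>2 pr_x\<^sub>1 pr_x\<^sub>2)"
  unfolding coeff_defs
  by (intro has_pullback_intros has_pullback_lin has_pullback_Qs;
      simp add: s\<^sub>1_nz s\<^sub>2_nz Qs_nz lin_y_nz)+

lemma coeffs_in_O_XX:
  "F\<^sub>1 x\<^sub>1 x\<^sub>2 \<in> O_XX" "F\<^sub>2 x\<^sub>1 x\<^sub>2 \<in> O_XX" "F\<^sub>3 x\<^sub>1 x\<^sub>2 \<in> O_XX" "F\<^sub>4 x\<^sub>1 x\<^sub>2 \<in> O_XX"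
  "G\<^sub>1 x\<^sub>1 x\<^sub>2 \<in> O_XX" "G\<^sub>2 x\<^sub>1 x\<^sub>2 \<in> O_XX"
  "N\<^sub>2\<^sub>1 x\<^sub>1 x\<^sub>2 \<in> O_XX" "N\<^sub>3\<^sub>2 x\<^sub>1 x\<^sub>2 \<in> O_XX" "H\<^sub>0 x\<^sub>1 x\<^sub>2 \<in> O_XX" "N\<^sub>4\<^sub>1 x\<^sub>1 x\<^sub>2 \<in> O_XX" "N\<^sub>4\<^sub>2 x\<^sub>1 x\<^sub>2 \<in> O_XX"
  unfolding coeff_defs lin_x
  by ((rule O_XX_intros(4))?; rule O_XX_divide; intro O_XX_inverse_mult O_XX_intros)+

text \<open>
  The relations: each of these functions is a twisted divergence. \<open>rel_a\<close> and \<open>rel_b\<close> reduce the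
  unmixed derivatives of \<open>\<phi>\<^sub>2\<close> and \<open>\<phi>\<^sub>3\<close>; the difference of \<open>rel_c\<close> and \<open>rel_d\<close>, together with
  \<open>rel_e\<close>, determines \<open>G\<^sub>1\<close> and \<open>G\<^sub>2\<close>; then either of \<open>rel_c\<close> and \<open>rel_d\<close> determines \<open>H\<^sub>0\<close>; and
  \<open>rel_g\<close> and \<open>rel_h\<close> form the linear system for the derivatives of \<open>\<phi>\<^sub>4\<close>.
\<close>

definition rel_a where "rel_a x x' = x * N\<^sub>2\<^sub>1 x x' + (\<mu>\<^sub>1 + \<mu>\<^sub>3) * F\<^sub>2 x x' + \<mu>\<^sub>3 * x * F\<^sub>4 x x'"
definition rel_b where "rel_b x x' = x' * N\<^sub>3\<^sub>2 x x' + (\<mu>\<^sub>2 + \<mu>\<^sub>3) * F\<^sub>3 x x' + \<mu>\<^sub>3 * x' * F\<^sub>4 x x'"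
definition rel_c where
  "rel_c x x' = x * x' * H\<^sub>0 x x' + \<mu>\<^sub>1 * F\<^sub>3 x x' + \<mu>\<^sub>3 * x' * (G\<^sub>2 x x' - F\<^sub>4 x x')"
definition rel_d where
  "rel_d x x' = x * x' * H\<^sub>0 x x' + \<mu>\<^sub>2 * F\<^sub>2 x x' + \<mu>\<^sub>3 * x * (G\<^sub>1 x x' - F\<^sub>4 x x')"
definition rel_e where
  "rel_e x x' = (\<mu>\<^sub>1 + \<mu>\<^sub>2 + \<mu>\<^sub>3) * F\<^sub>1 x x' - \<mu>\<^sub>4 * (F\<^sub>2 x x' + F\<^sub>3 x x')
     + \<mu>\<^sub>3 * (F\<^sub>4 x x' - x * G\<^sub>1 x x' - x' * G\<^sub>2 x x')"
definition rel_g where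
  "rel_g x x' = (1 - x - x') * N\<^sub>4\<^sub>1 x x' - (x' + x') * N\<^sub>4\<^sub>2 x x' + (\<mu>\<^sub>1 + \<mu>\<^sub>3 + \<mu>\<^sub>4) * G\<^sub>1 x x'
     - (\<mu>\<^sub>1 + \<mu>\<^sub>2 + \<mu>\<^sub>3 + 1) * F\<^sub>4 x x' - x' * H\<^sub>0 x x'"
definition rel_h where
  "rel_h x x' = (1 - x - x') * N\<^sub>4\<^sub>2 x x' - (x + x) * N\<^sub>4\<^sub>1 x x' + (\<mu>\<^sub>2 + \<mu>\<^sub>3 + \<mu>\<^sub>4) * G\<^sub>2 x x'
     - (\<mu>\<^sub>1 + \<mu>\<^sub>2 + \<mu>\<^sub>3 + 1) * F\<^sub>4 x x' - x * H\<^sub>0 x x'"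

lemmas rel_defs = rel_a_def rel_b_def rel_c_def rel_d_def rel_e_def rel_g_def rel_h_def

lemma has_pullback_rels:
  "has_pullback (rel_a x\<^sub>1 x\<^sub>2) (rel_a pr_x\<^sub>1 pr_x\<^sub>2)" "has_pullback (rel_b x\<^sub>1 x\<^sub>2) (rel_b pr_x\<^sub>1 pr_x\<^sub>2)"
  "has_pullback (rel_c x\<^sub>1 x\<^sub>2) (rel_c pr_x\<^sub>1 pr_x\<^sub>2)" "has_pullback (rel_d x\<^sub>1 x\<^sub>2) (rel_d pr_x\<^sub>1 pr_x\<^sub>2)"
  "has_pullback (rel_e x\<^sub>1 x\<^sub>2) (rel_e pr_x\<^sub>1 pr_x\<^sub>2)" "has_pullback (rel_g x\<^sub>1 x\<^sub>2) (rel_g pr_x\<^sub>1 pr_x\<^sub>2)"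
  "has_pullback (rel_h x\<^sub>1 x\<^sub>2) (rel_h pr_x\<^sub>1 pr_x\<^sub>2)"
  unfolding rel_defs by (intro has_pullback_intros has_pullback_coeffs)+

lemmas nonzero = s\<^sub>1_nz s\<^sub>2_nz Qs_nz Lsx_nz x\<^sub>1_nz x\<^sub>2_nz

text \<open>
  The vector fields behind the relations. In the first two, \<open>s\<^sub>1 (s\<^sub>2 - 1) = Q + s\<^sub>2\<close> and its mirror
  image keep the pole along \<open>Q\<close> within the frame. In the last two, \<open>s\<^sub>1 (s\<^sub>1 - 1) \<partial>\<^sub>1 - s\<^sub>2 \<partial>\<^sub>2\<close> and
  \<open>- s\<^sub>1 \<partial>\<^sub>1 + s\<^sub>2 (s\<^sub>2 - 1) \<partial>\<^sub>2\<close> are fields tangent to \<open>s\<^sub>1 = 0\<close>, \<open>s\<^sub>2 = 0\<close> and \<open>Q = 0\<close>: they map \<open>Q\<close> to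
  \<open>(s\<^sub>1 - 1) Q\<close> and \<open>(s\<^sub>2 - 1) Q\<close>, which is why they may be divided by \<open>Q L\<close> without creating a
  double pole along \<open>Q = 0\<close>.
\<close>

lemma twisted_div_a: "twisted_div (s\<^sub>1 * x\<^sub>1 / (s\<^sub>2 * Lsx)) 0 = rel_a x\<^sub>1 x\<^sub>2"
  unfolding twisted_div_def dlog\<^sub>1_def rel_defs coeff_defs lin_x
  by (simp add: pd_simps pd_Qs pd_Lsx nonzero divide_simps)
    (simp add: Qs_def Lsx_def algebra_simps)

lemma twisted_div_b: "twisted_div (0) (s\<^sub>2 * x\<^sub>2 / (s\<^sub>1 * Lsx)) = rel_b x\<^sub>1 x\<^sub>2"
  unfolding twisted_div_def dlog\<^sub>1_def dlog\<^sub>2_def rel_defs coeff_defs lin_x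
  by (simp add: pd_simps pd_Qs pd_Lsx nonzero divide_simps)
    (simp add: Qs_def Lsx_def algebra_simps)

lemma twisted_div_c: "twisted_div (x\<^sub>2 / Lsx) (0) = rel_c x\<^sub>1 x\<^sub>2"
  unfolding twisted_div_def dlog\<^sub>1_def dlog\<^sub>2_def rel_defs coeff_defs lin_x
  by (simp add: pd_simps pd_Qs pd_Lsx nonzero divide_simps)
    (simp add: Qs_def Lsx_def algebra_simps)

lemma twisted_div_d: "twisted_div (0) (x\<^sub>1 / Lsx) = rel_d x\<^sub>1 x\<^sub>2"
  unfolding twisted_div_def dlog\<^sub>1_def dlog\<^sub>2_def rel_defs coeff_defs lin_x
  by (simp add: pd_simps pd_Qs pd_Lsx nonzero divide_simps)
    (simp add: Qs_def Lsx_def algebra_simps)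

lemma twisted_div_e: "twisted_div (1 / s\<^sub>2) (1 / s\<^sub>1) = rel_e x\<^sub>1 x\<^sub>2"
  unfolding twisted_div_def dlog\<^sub>1_def dlog\<^sub>2_def rel_defs coeff_defs lin_x
  by (simp add: pd_simps pd_Qs pd_Lsx nonzero divide_simps)
    (simp add: Qs_def Lsx_def algebra_simps)

lemma twisted_div_g: "twisted_div (s\<^sub>1 * (s\<^sub>1 - 1) / (Qs * Lsx)) (- s\<^sub>2 / (Qs * Lsx)) = rel_g x\<^sub>1 x\<^sub>2"
  unfolding twisted_div_def dlog\<^sub>1_def dlog\<^sub>2_def rel_defs coeff_defs lin_x
  by (simp add: pd_simps pd_Qs pd_Lsx nonzero divide_simps)
    (simp add: Qs_def Lsx_def algebra_simps)

lemma twisted_div_h: "twisted_div (- s\<^sub>1 / (Qs * Lsx)) (s\<^sub>2 * (s\<^sub>2 - 1) / (Qs * Lsx)) = rel_h x\<^sub>1 x\<^sub>2"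
  unfolding twisted_div_def dlog\<^sub>1_def dlog\<^sub>2_def rel_defs coeff_defs lin_x
  by (simp add: pd_simps pd_Qs pd_Lsx nonzero divide_simps)
    (simp add: Qs_def Lsx_def algebra_simps)


lemma s_fraction_in_O_XX:
  "s\<^sub>1 * x\<^sub>1 / (s\<^sub>2 * Lsx) \<in> O_XX" "s\<^sub>2 * x\<^sub>2 / (s\<^sub>1 * Lsx) \<in> O_XX" "x\<^sub>1 / Lsx \<in> O_XX" "x\<^sub>2 / Lsx \<in> O_XX"
  "s\<^sub>1 * (s\<^sub>1 - 1) / (Qs * Lsx) \<in> O_XX" "- s\<^sub>2 / (Qs * Lsx) \<in> O_XX"
  "- s\<^sub>1 / (Qs * Lsx) \<in> O_XX" "s\<^sub>2 * (s\<^sub>2 - 1) / (Qs * Lsx) \<in> O_XX"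
  by (rule O_XX_divide; intro O_XX_inverse_mult O_XX_intros)+

lemma rels_exact:
  assumes "l \<in> {2, 3}"
  shows "rel_a pr_x\<^sub>1 pr_x\<^sub>2 \<in> exact l" "rel_b pr_x\<^sub>1 pr_x\<^sub>2 \<in> exact l" "rel_c pr_x\<^sub>1 pr_x\<^sub>2 \<in> exact l"
    "rel_d pr_x\<^sub>1 pr_x\<^sub>2 \<in> exact l" "rel_e pr_x\<^sub>1 pr_x\<^sub>2 \<in> exact l"
    "rel_g pr_x\<^sub>1 pr_x\<^sub>2 \<in> exact l" "rel_h pr_x\<^sub>1 pr_x\<^sub>2 \<in> exact l"
proof -
  note ex = twisted_div_exact[OF _ _ _ assms] and fr = s_fraction_in_O_XX and gens = O_XX_intros
  show "rel_a pr_x\<^sub>1 pr_x\<^sub>2 \<in> exact l"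
    by (rule ex[OF fr(1) gens(2)]) (simp only: twisted_div_a has_pullback_rels)
  show "rel_b pr_x\<^sub>1 pr_x\<^sub>2 \<in> exact l"
    by (rule ex[OF gens(2) fr(2)]) (simp only: twisted_div_b has_pullback_rels)
  show "rel_c pr_x\<^sub>1 pr_x\<^sub>2 \<in> exact l"
    by (rule ex[OF fr(4) gens(2)]) (simp only: twisted_div_c has_pullback_rels)
  show "rel_d pr_x\<^sub>1 pr_x\<^sub>2 \<in> exact l"
    by (rule ex[OF gens(2) fr(3)]) (simp only: twisted_div_d has_pullback_rels)
  show "rel_e pr_x\<^sub>1 pr_x\<^sub>2 \<in> exact l"
    by (rule ex[OF O_XX_gens(7,6)]) (simp only: twisted_div_e has_pullback_rels)
  show "rel_g pr_x\<^sub>1 pr_x\<^sub>2 \<in> exact l"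
    by (rule ex[OF fr(5,6)]) (simp only: twisted_div_g has_pullback_rels)
  show "rel_h pr_x\<^sub>1 pr_x\<^sub>2 \<in> exact l"
    by (rule ex[OF fr(7,8)]) (simp only: twisted_div_h has_pullback_rels)
qed

section \<open>Uniqueness of the connection matrix\<close>

lemma nabla_add: "nabla (\<alpha> + \<beta>) = nabla \<alpha> + nabla \<beta>"
  by (simp add: nabla_def d_s_def ext_d_add wedge_add_right)

lemma Omega_1_1_cases:
  assumes "\<eta> \<in> Omega 1 1"
  obtains a b c d where "a \<in> O_XX" "b \<in> O_XX" "c \<in> O_XX" "d \<in> O_XX"
    "\<eta> = (monoform {Suc 0, 2} a + monoform {0, 2} (- b)) + (monoform {Suc 0, 3} c + monoform {0, 3} (- d))"
proof -
  have mem: "\<eta> I \<in> O_XX"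
    and sub: "\<eta> I \<noteq> 0 \<Longrightarrow> I \<subseteq> {0, 1, 2, 3}" and s: "\<eta> I \<noteq> 0 \<Longrightarrow> card (I \<inter> {0, 1}) = 1"
    and x: "\<eta> I \<noteq> 0 \<Longrightarrow> card (I \<inter> {2, 3}) = 1" for I
    using assms by (auto simp: Omega_def forms_over_def)
  have supp: "I \<in> {{0, 2}, {0, 3}, {Suc 0, 2}, {Suc 0, 3}}" if nz: "\<eta> I \<noteq> 0" for I
  proof -
    obtain i where i: "I \<inter> {0, 1} = {i}"
      using s[OF nz] by (rule card_1_singletonE)
    obtain j where j: "I \<inter> {2, 3} = {j}"
      using x[OF nz] by (rule card_1_singletonE)
    have "I = (I \<inter> {0, 1}) \<union> (I \<inter> {2, 3})"
      using sub[OF nz] by auto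
    then have "I = {i} \<union> {j}"
      unfolding i j .
    moreover have "i \<in> {0, 1}" "j \<in> {2, 3}"
      using i j by blast+
    ultimately show ?thesis
      by auto
  qed
  have eq: "\<eta> = (monoform {Suc 0, 2} (\<eta> {Suc 0, 2}) + monoform {0, 2} (- (- \<eta> {0, 2})))
      + (monoform {Suc 0, 3} (\<eta> {Suc 0, 3}) + monoform {0, 3} (- (- \<eta> {0, 3})))" (is "_ = ?r")
  proof
    fix I
    show "\<eta> I = ?r I"
    proof (cases "I \<in> {{0, 2}, {0, 3}, {Suc 0, 2}, {Suc 0, 3}}")
      case True
      then consider "I = {0, 2}" | "I = {0, 3}" | "I = {Suc 0, 2}" | "I = {Suc 0, 3}"
        by blast
      then show ?thesis
        by cases (simp_all add: monoform_def doubleton_eq_iff)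
    next
      case False
      with supp[of I] have "\<eta> I = 0"
        by blast
      with False show ?thesis
        by (simp add: monoform_def)
    qed
  qed
  show ?thesis
    by (rule that[OF mem _ mem _ eq]) (intro is_subringD(3)[OF is_subring_O_XX] mem)+
qed

text \<open>
  \<open>\<nabla>\<close> differentiates only in \<open>s\<close>, so it commutes with taking the coefficient of a \<open>dx\<^sub>k\<close>; the
  coefficients of \<open>dy\<^sub>1\<close> and \<open>dy\<^sub>2\<close> are \<open>O(Y)\<close>-combinations of those of \<open>pr\<^sup>*dx\<^sub>1\<close> and \<open>pr\<^sup>*dx\<^sub>2\<close>.
\<close>

lemma pr_module_nabla_component:
  assumes "u \<in> pr_module (nabla ` Omega 1 1)" and l: "l \<in> {2, 3}"
  shows "monoform {0, Suc 0} (u {0, Suc 0, l}) \<in> pr_module (nabla ` Omega 1 0)"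
  using assms(1)
proof (induction rule: pr_module_induct)
  case zero
  have "monoform {0, Suc 0} ((0 :: form) {0, Suc 0, l}) = 0"
    by (auto simp: monoform_def)
  then show ?case
    by (simp only: pr_module_0)
next
  case (add \<alpha> \<beta>)
  have "(\<alpha> + \<beta>) {0, Suc 0, l} = \<alpha> {0, Suc 0, l} + \<beta> {0, Suc 0, l}"
    by simp
  with add show ?case
    by (simp only: monoform_add pr_module_add)
next
  case (scal f \<eta>')
  then obtain \<eta> where \<eta>: "\<eta> \<in> Omega 1 1" "\<eta>' = nabla \<eta>"
    by blast
  obtain a b c d where in_O: "a \<in> O_XX" "b \<in> O_XX" "c \<in> O_XX" "d \<in> O_XX"
    and "\<eta> = (monoform {Suc 0, 2} a + monoform {0, 2} (- b))
      + (monoform {Suc 0, 3} c + monoform {0, 3} (- d))"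
    using Omega_1_1_cases[OF \<eta>(1)] .
  with \<eta> have \<eta>': "\<eta>' = monoform {0, Suc 0, 2} (twisted_div a b)
      + monoform {0, Suc 0, 3} (twisted_div c d)"
    by (simp only: nabla_twisted_div
        nabla_add[of "monoform {Suc 0, 2} a + monoform {0, 2} (- b)"])
  have neq: "{0, Suc 0, 2} \<noteq> {0, Suc 0, 3 :: nat}"
    by (simp add: insert_eq_iff)
  let ?v = "pr_fun (twisted_div a b)" and ?w = "pr_fun (twisted_div c d)"
  have comp: "pr_form \<eta>' {0, Suc 0, 2} = (1 - y\<^sub>2) * ?v - y\<^sub>2 * ?w"
    "pr_form \<eta>' {0, Suc 0, 3} = - y\<^sub>1 * ?v + (1 - y\<^sub>1) * ?w"
    unfolding \<eta>' using neq
    by (subst pr_form_add_disjoint; simp add: pr_form_simps; simp add: monoform_def)+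
  have "monoform {0, Suc 0} (twisted_div g h) \<in> nabla ` Omega 1 0" if "g \<in> O_XX" "h \<in> O_XX" for g h
  proof (rule image_eqI)
    show "monoform {0, Suc 0} (twisted_div g h) = nabla (monoform {Suc 0} g + monoform {0} (- h))"
      by (simp only: nabla_twisted_div)
    show "monoform {Suc 0} g + monoform {0} (- h) \<in> Omega 1 0"
      unfolding Omega_def using that
      by (intro forms_over_add forms_over_monoform is_subring_O_XX O_XX_intros) auto
  qed
  then have base: "monoform {0, Suc 0} (pr_fun (twisted_div g h)) \<in> pr_module (nabla ` Omega 1 0)"
    if "g \<in> O_XX" "h \<in> O_XX" for g h
    using that pr_form_in_pr_module[of "monoform {0, Suc 0} (twisted_div g h)"] by (simp add: pr_form_simps)
  have comb: "monoform {0, Suc 0} (f * (p * ?v + q * ?w)) \<in> pr_module (nabla ` Omega 1 0)"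
    if "p \<in> O_Y" "q \<in> O_Y" for p q
  proof -
    have "monoform {0, Suc 0} (f * (p * ?v + q * ?w)) =
        f \<bullet>\<^sub>f (p \<bullet>\<^sub>f monoform {0, Suc 0} ?v + q \<bullet>\<^sub>f monoform {0, Suc 0} ?w)"
      by (simp only: scal_monoform flip: monoform_add)
    then show ?thesis
      using base in_O that scal(1) by (simp only:) (intro pr_module_scal pr_module_add; blast)
  qed
  have entries: "(f \<bullet>\<^sub>f pr_form \<eta>') {0, Suc 0, 2} = f * ((1 - y\<^sub>2) * ?v + (- y\<^sub>2) * ?w)"
    "(f \<bullet>\<^sub>f pr_form \<eta>') {0, Suc 0, 3} = f * ((- y\<^sub>1) * ?v + (1 - y\<^sub>1) * ?w)"
    by (simp_all add: scal_def comp)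
  from l consider "l = 2" | "l = 3"
    by blast
  then show ?case
  proof cases
    case 1
    show ?thesis
      unfolding 1 entries by (rule comb; intro O_Y_intros)
  next
    case 2
    show ?thesis
      unfolding 2 entries by (rule comb; intro O_Y_intros)
  qed
qed

lemma one_form_on_Y_cases:
  assumes "\<theta> \<in> forms_over O_Y 0 1"
  shows "\<theta> {2} \<in> O_Y" "\<theta> {3} \<in> O_Y" "\<theta> = monoform {2} (\<theta> {2}) + monoform {3} (\<theta> {3})"
proof -
  have sub: "\<theta> I \<noteq> 0 \<Longrightarrow> I \<subseteq> {0, 1, 2, 3}" and s: "\<theta> I \<noteq> 0 \<Longrightarrow> card (I \<inter> {0, 1}) = 0"
    and x: "\<theta> I \<noteq> 0 \<Longrightarrow> card (I \<inter> {2, 3}) = 1" for I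
    using assms by (auto simp: forms_over_def)
  show "\<theta> {2} \<in> O_Y" "\<theta> {3} \<in> O_Y"
    using assms by (auto simp: forms_over_def)
  have "I \<in> {{2}, {3}}" if nz: "\<theta> I \<noteq> 0" for I
  proof -
    obtain j where j: "I \<inter> {2, 3} = {j}"
      using x[OF nz] by (rule card_1_singletonE)
    have "I \<inter> {0, 1} = {}"
      using s[OF nz] by simp
    then have "I = I \<inter> {2, 3}"
      using sub[OF nz] by auto
    then have "I = {j}"
      unfolding j .
    moreover have "j \<in> {2, 3}"
      using j by blast
    ultimately show ?thesis
      by auto
  qed
  then show "\<theta> = monoform {2} (\<theta> {2}) + monoform {3} (\<theta> {3})"
    by (intro ext) (auto simp: monoform_def)
qed

lemma wedge_one_form:
  "(monoform {2} a + monoform {3} b) \<and>\<^sub>f monoform {0, Suc 0} u =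
    monoform {0, Suc 0, 2} (a * u) + monoform {0, Suc 0, 3} (b * u)"
  by (simp add: form_simps)

text \<open>
  Comparing the \<open>dy\<close>-coefficients of the two expressions for the derivative of \<open>e\<^sub>i\<close> gives a
  combination of the \<open>e\<^sub>j\<close> with coefficients in \<open>O(Y)\<close> whose class is zero. A frame represents the
  zero class in only one way.
\<close>

lemma connection_matrix_unique:
  assumes frame: "is_frame e" and e: "\<And>i. e $ i = monoform {0, Suc 0} (u i)"
    and M: "is_connection_matrix e M" and M': "is_connection_matrix e M'"
  shows "M = M'"
proof -
  have coeff_eq: "(M $ i $ j) {l} = (M' $ i $ j) {l}" if l: "l \<in> {2, 3}" for i j and l :: nat
  proof -
    let ?N = "pr_module (nabla ` Omega 1 1)"
    define \<Delta> where "\<Delta> j = (M $ i $ j) {l} - (M' $ i $ j) {l}" for j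
    have form: "M $ i $ j \<in> forms_over O_Y 0 1" "M' $ i $ j \<in> forms_over O_Y 0 1" for j
      using M M' by (auto simp: is_connection_matrix_def)
    have "nabla_Y (e $ i) - (\<Sum>j\<in>UNIV. M' $ i $ j \<and>\<^sub>f e $ j) \<in> ?N"
      "nabla_Y (e $ i) - (\<Sum>j\<in>UNIV. M $ i $ j \<and>\<^sub>f e $ j) \<in> ?N"
      using M M' unfolding is_connection_matrix_def same_class_def by blast+
    then have "(nabla_Y (e $ i) - (\<Sum>j\<in>UNIV. M' $ i $ j \<and>\<^sub>f e $ j))
        - (nabla_Y (e $ i) - (\<Sum>j\<in>UNIV. M $ i $ j \<and>\<^sub>f e $ j)) \<in> ?N"
      by (rule pr_module_diff)
    then have "(\<Sum>j\<in>UNIV. M $ i $ j \<and>\<^sub>f e $ j) - (\<Sum>j\<in>UNIV. M' $ i $ j \<and>\<^sub>f e $ j) \<in> ?N"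
      by (simp add: algebra_simps)
    from pr_module_nabla_component[OF this l]
    have comp: "monoform {0, Suc 0} (((\<Sum>j\<in>UNIV. M $ i $ j \<and>\<^sub>f e $ j) - (\<Sum>j\<in>UNIV. M' $ i $ j \<and>\<^sub>f e $ j))
        {0, Suc 0, l}) \<in> pr_module (nabla ` Omega 1 0)" .
    have entry: "(\<theta> \<and>\<^sub>f e $ j) {0, Suc 0, l} = \<theta> {l} * u j" if "\<theta> \<in> forms_over O_Y 0 1" for \<theta> j
    proof -
      have neq: "{0, Suc 0, 2} \<noteq> {0, Suc 0, 3 :: nat}"
        by (simp add: insert_eq_iff)
      have eq: "\<theta> \<and>\<^sub>f e $ j = monoform {0, Suc 0, 2} (\<theta> {2} * u j) + monoform {0, Suc 0, 3} (\<theta> {3} * u j)"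
        by (subst one_form_on_Y_cases(3)[OF that]) (simp only: e wedge_one_form)
      from l consider "l = 2" | "l = 3"
        by blast
      then show ?thesis
        unfolding eq by cases (use neq in \<open>simp_all add: monoform_def\<close>)
    qed
    have "((\<Sum>j\<in>UNIV. M $ i $ j \<and>\<^sub>f e $ j) - (\<Sum>j\<in>UNIV. M' $ i $ j \<and>\<^sub>f e $ j)) {0, Suc 0, l}
        = (\<Sum>j\<in>UNIV. \<Delta> j * u j)"
      by (simp add: sum_4 entry[OF form(1)] entry[OF form(2)] \<Delta>_def algebra_simps)
    with comp have comp0: "monoform {0, Suc 0} (\<Sum>j\<in>UNIV. \<Delta> j * u j) \<in> pr_module (nabla ` Omega 1 0)"
      by simp
    define P :: "ratfun ^ 4 \<Rightarrow> bool" where "P c \<longleftrightarrow> (\<forall>i. c $ i \<in> O_Y)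
      \<and> same_class (pr_module (nabla ` Omega 1 0)) 0 (\<Sum>i\<in>UNIV. c $ i \<bullet>\<^sub>f e $ i)" for c
    have "\<exists>!c. P c"
      unfolding P_def by (rule bspec[OF conjunct2[OF frame[unfolded is_frame_def]] pr_module_0])
    moreover have "P (\<chi> j. \<Delta> j)"
    proof -
      have "\<Delta> j \<in> O_Y" for j
        unfolding \<Delta>_def using form[of j] by (intro O_Y_intros) (auto simp: forms_over_def)
      moreover have "0 - (\<Sum>j\<in>UNIV. (\<chi> j. \<Delta> j) $ j \<bullet>\<^sub>f e $ j) \<in> pr_module (nabla ` Omega 1 0)"
        by (rule pr_module_diff[OF pr_module_0])
          (use comp0 in \<open>simp only: vec_lambda_beta e scal_monoform monoform_sum\<close>)
      ultimately show ?thesis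
        by (simp only: P_def same_class_def vec_lambda_beta simp_thms)
    qed
    moreover have "P (\<chi> j. 0)"
    proof -
      have "0 - (\<Sum>j\<in>UNIV. (\<chi> j. 0) $ j \<bullet>\<^sub>f e $ j) = 0"
        by (simp only: vec_lambda_beta scal_0_left sum.neutral_const diff_0_right)
      then show ?thesis
        by (simp only: P_def same_class_def pr_module_0 vec_lambda_beta O_Y_intros(2) simp_thms)
    qed
    ultimately have "(\<chi> j. \<Delta> j) = (\<chi> j. 0)"
      by blast
    then have "\<Delta> j = 0"
      by (metis vec_lambda_beta)
    then show ?thesis
      by (simp add: \<Delta>_def)
  qed
  have "M $ i $ j = M' $ i $ j" for i j
  proof -
    have "M $ i $ j = monoform {2} ((M $ i $ j) {2}) + monoform {3} ((M $ i $ j) {3})"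
      using M unfolding is_connection_matrix_def by (blast intro: one_form_on_Y_cases(3))
    also have "\<dots> = monoform {2} ((M' $ i $ j) {2}) + monoform {3} ((M' $ i $ j) {3})"
      using coeff_eq[of 2 i j] coeff_eq[of 3 i j] by simp
    also have "\<dots> = M' $ i $ j"
      using M' unfolding is_connection_matrix_def by (blast intro: one_form_on_Y_cases(3)[symmetric])
    finally show ?thesis .
  qed
  then show ?thesis
    by (simp add: vec_eq_iff)
qed

section \<open>The coefficient matrices\<close>

lemma vector_4:
  "(vector [a, b, c, d] :: 'a :: zero ^ 4) $ 1 = a" "(vector [a, b, c, d] :: 'a ^ 4) $ 2 = b"
  "(vector [a, b, c, d] :: 'a ^ 4) $ 3 = c" "(vector [a, b, c, d] :: 'a ^ 4) $ 4 = d"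
  unfolding vector_def by simp_all

lemma I\<^sub>3\<^sub>1_entry: "I\<^sub>3\<^sub>1 $ i $ j = (if i = j then if i = 4 then - 1 else 1 else 0)"
  using exhaust_4[of i] by (auto simp: I\<^sub>3\<^sub>1_def diag4_def vector_4)

lemma I\<^sub>3\<^sub>1_mult_left: "(I\<^sub>3\<^sub>1 ** X) $ i $ j = (if i = 4 then - X $ i $ j else X $ i $ j)"
  by (simp add: matrix_matrix_mult_def I\<^sub>3\<^sub>1_entry if_distrib[of "\<lambda>x. x * _"] cong: if_cong)

lemma I\<^sub>3\<^sub>1_mult_right: "(X ** I\<^sub>3\<^sub>1) $ i $ j = (if j = 4 then - X $ i $ j else X $ i $ j)"
  by (simp add: matrix_matrix_mult_def I\<^sub>3\<^sub>1_entry if_distrib[of "\<lambda>x. _ * x"] cong: if_cong)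

lemma I\<^sub>3\<^sub>1_involution: "I\<^sub>3\<^sub>1 ** I\<^sub>3\<^sub>1 = mat 1"
  by (simp add: vec_eq_iff I\<^sub>3\<^sub>1_mult_left I\<^sub>3\<^sub>1_entry mat_def)

lemma matrix_inv_I\<^sub>3\<^sub>1: "matrix_inv I\<^sub>3\<^sub>1 = I\<^sub>3\<^sub>1"
proof -
  have "I\<^sub>3\<^sub>1 ** matrix_inv I\<^sub>3\<^sub>1 = mat 1"
    unfolding matrix_inv_def by (rule someI2[of _ I\<^sub>3\<^sub>1]) (simp_all add: I\<^sub>3\<^sub>1_involution)
  then have "I\<^sub>3\<^sub>1 ** (I\<^sub>3\<^sub>1 ** matrix_inv I\<^sub>3\<^sub>1) = I\<^sub>3\<^sub>1"
    by simp
  then show ?thesis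
    by (simp add: matrix_mul_assoc I\<^sub>3\<^sub>1_involution)
qed

definition conj_I :: "K ^ 4 ^ 4 \<Rightarrow> K ^ 4 ^ 4" where
  "conj_I X = I\<^sub>3\<^sub>1 ** X ** matrix_inv I\<^sub>3\<^sub>1"

lemma conj_I_entry: "conj_I X $ i $ j = (if (i = 4) = (j = 4) then X $ i $ j else - X $ i $ j)"
  by (simp add: conj_I_def matrix_inv_I\<^sub>3\<^sub>1 I\<^sub>3\<^sub>1_mult_right I\<^sub>3\<^sub>1_mult_left)

text \<open>
  The coefficients of \<open>dy\<^sub>1\<close> and \<open>dy\<^sub>2\<close> in the entries of \<open>Xi_hat\<close>.
\<close>

definition conn\<^sub>1 :: "4 \<Rightarrow> 4 \<Rightarrow> ratfun" where
  "conn\<^sub>1 i j = cst (Xi\<^sub>1 $ i $ j) * (1 / y\<^sub>1) + cst (conj_I Xi\<^sub>2 $ i $ j) * (1 / (y\<^sub>1 - 1))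
     + cst (Xi\<^sub>3 $ i $ j) * (1 / (y\<^sub>1 + y\<^sub>2 - 1))"

definition conn\<^sub>2 :: "4 \<Rightarrow> 4 \<Rightarrow> ratfun" where
  "conn\<^sub>2 i j = cst (Xi\<^sub>2 $ i $ j) * (1 / y\<^sub>2) + cst (conj_I Xi\<^sub>1 $ i $ j) * (1 / (y\<^sub>2 - 1))
     + cst (Xi\<^sub>3 $ i $ j) * (1 / (y\<^sub>1 + y\<^sub>2 - 1))"

lemma Xi_hat_entry: "Xi_hat $ i $ j = monoform {2} (conn\<^sub>1 i j) + monoform {3} (conn\<^sub>2 i j)"
  unfolding Xi_hat_def conj_I_def[symmetric] mat_form_def dy\<^sub>1_def dy\<^sub>2_def dz_eq_monoform
  by (simp add: scal_add scal_monoform conn\<^sub>1_def conn\<^sub>2_def monoform_add)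

lemma conn_in_O_Y: "conn\<^sub>1 i j \<in> O_Y" "conn\<^sub>2 i j \<in> O_Y"
  unfolding conn\<^sub>1_def conn\<^sub>2_def by (intro O_Y_intros)+

section \<open>Flatness\<close>

lemma Xi_closed: "d_y_mat Xi_hat = 0"
proof -
  have "pd 2 (conn\<^sub>2 i j) = pd 3 (conn\<^sub>1 i j)" for i j
    by (simp add: conn\<^sub>1_def conn\<^sub>2_def pd_simps)
  then have "d_y (Xi_hat $ i $ j) = 0" for i j
    by (simp add: Xi_hat_entry d_y_def ext_d_add ext_d_monoform form_simps monoform_minus)
  then show ?thesis
    by (simp add: d_y_mat_def vec_eq_iff)
qed

abbreviation "Xi\<^sub>1' \<equiv> conj_I Xi\<^sub>1"
abbreviation "Xi\<^sub>2' \<equiv> conj_I Xi\<^sub>2"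

lemmas matrix_comm = vec_eq_iff forall_4 matrix_matrix_mult_def sum_4 conj_I_entry Xi\<^sub>1_def Xi\<^sub>2_def Xi\<^sub>3_def
  diag4_def vector_4 lam\<^sub>1\<^sub>2\<^sub>3_def lam\<^sub>1\<^sub>3\<^sub>4'_def lam\<^sub>2\<^sub>3\<^sub>4'_def

text \<open>
  The first two identities belong to the normal crossings \<open>(0, 0)\<close> and \<open>(1, 1)\<close>. The next two
  belong to \<open>(0, 1)\<close>, where \<open>y\<^sub>1 = 0\<close>, \<open>y\<^sub>2 = 1\<close> and \<open>y\<^sub>1 + y\<^sub>2 = 1\<close> meet, and say that each residue
  commutes with the sum of the three; the last two belong in the same way to \<open>(1, 0)\<close>.
\<close>

lemma Xi_commutators:
  "Xi\<^sub>1 ** Xi\<^sub>2 = Xi\<^sub>2 ** Xi\<^sub>1"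
  "Xi\<^sub>2' ** Xi\<^sub>1' = Xi\<^sub>1' ** Xi\<^sub>2'"
  "Xi\<^sub>1 ** Xi\<^sub>3 - Xi\<^sub>3 ** Xi\<^sub>1 = Xi\<^sub>1' ** Xi\<^sub>1 - Xi\<^sub>1 ** Xi\<^sub>1'"
  "Xi\<^sub>3 ** Xi\<^sub>1' - Xi\<^sub>1' ** Xi\<^sub>3 = Xi\<^sub>1' ** Xi\<^sub>1 - Xi\<^sub>1 ** Xi\<^sub>1'"
  "Xi\<^sub>2' ** Xi\<^sub>3 - Xi\<^sub>3 ** Xi\<^sub>2' = Xi\<^sub>2 ** Xi\<^sub>2' - Xi\<^sub>2' ** Xi\<^sub>2"
  "Xi\<^sub>3 ** Xi\<^sub>2 - Xi\<^sub>2 ** Xi\<^sub>3 = Xi\<^sub>2 ** Xi\<^sub>2' - Xi\<^sub>2' ** Xi\<^sub>2"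
  subgoal by (simp add: matrix_comm divide_simps lam\<^sub>3_nz numeral_neq_zero_K) (simp add: algebra_simps)
  subgoal by (simp add: matrix_comm divide_simps lam\<^sub>3_nz numeral_neq_zero_K) (simp add: algebra_simps)
  subgoal by (simp add: matrix_comm divide_simps lam\<^sub>3_nz numeral_neq_zero_K) (simp add: algebra_simps)
  subgoal by (simp add: matrix_comm divide_simps lam\<^sub>3_nz numeral_neq_zero_K) (simp add: algebra_simps)
  subgoal by (simp add: matrix_comm divide_simps lam\<^sub>3_nz numeral_neq_zero_K) (simp add: algebra_simps)
  subgoal by (simp add: matrix_comm divide_simps lam\<^sub>3_nz numeral_neq_zero_K) (simp add: algebra_simps)
  done

lemma sum_trilinear_product:
  fixes p q r u v w :: "'a :: comm_ring_1"
  shows "(\<Sum>k\<in>S. (a k * p + a' k * q + a'' k * r) * (b k * u + b' k * v + b'' k * w)) =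
    (\<Sum>k\<in>S. a k * b k) * (p * u) + (\<Sum>k\<in>S. a k * b' k) * (p * v) + (\<Sum>k\<in>S. a k * b'' k) * (p * w)
    + ((\<Sum>k\<in>S. a' k * b k) * (q * u) + (\<Sum>k\<in>S. a' k * b' k) * (q * v) + (\<Sum>k\<in>S. a' k * b'' k) * (q * w))
    + ((\<Sum>k\<in>S. a'' k * b k) * (r * u) + (\<Sum>k\<in>S. a'' k * b' k) * (r * v) + (\<Sum>k\<in>S. a'' k * b'' k) * (r * w))"
  by (simp add: algebra_simps sum.distrib sum_distrib_left sum_distrib_right)

lemma cst_matrix_product: "(\<Sum>k\<in>UNIV. cst (X $ i $ k) * cst (Z $ k $ j)) = cst ((X ** Z) $ i $ j)"
  for X Z :: "K ^ 4 ^ 4"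
  by (simp add: matrix_matrix_mult_def sum_4 cst_add cst_mult)

text \<open>
  The relation between the logarithmic forms of three concurrent lines.
\<close>

lemma inverse_triangle:
  fixes p q s :: "'a :: field"
  assumes "p + q = s" "p \<noteq> 0" "q \<noteq> 0" "s \<noteq> 0"
  shows "1 / p * (1 / q) = 1 / p * (1 / s) + 1 / s * (1 / q)"
  using assms(2-4) by (simp add: divide_simps) (simp add: assms(1)[symmetric] add.commute)

text \<open>
  The variables \<open>p, q, u, v, s\<close> stand for the reciprocals of \<open>y\<^sub>1\<close>, \<open>y\<^sub>1 - 1\<close>, \<open>y\<^sub>2\<close>, \<open>y\<^sub>2 - 1\<close> and
  \<open>y\<^sub>1 + y\<^sub>2 - 1\<close>. At each triple point the three differences of products of residues are
  \<open>k, - k, - k\<close>, so they cancel by the relation between the three reciprocals.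
\<close>

lemma residue_cancellation:
  fixes p q u v s :: "'a :: comm_ring_1"
  assumes "p * v = p * s + s * v" "q * u = q * s + s * u"
    and "c\<^sub>1 - c\<^sub>1' = k" "d\<^sub>1 - d\<^sub>1' = - k" "e\<^sub>1 - e\<^sub>1' = - k"
    and "c\<^sub>2 - c\<^sub>2' = m" "d\<^sub>2 - d\<^sub>2' = - m" "e\<^sub>2 - e\<^sub>2' = - m"
  shows "a * (p * u) + c\<^sub>1 * (p * v) + d\<^sub>1 * (p * s) + (c\<^sub>2 * (q * u) + b * (q * v) + d\<^sub>2 * (q * s))
      + (e\<^sub>2 * (s * u) + e\<^sub>1 * (s * v) + f * (s * s))
    = a * (u * p) + c\<^sub>2' * (u * q) + e\<^sub>2' * (u * s) + (c\<^sub>1' * (v * p) + b * (v * q) + e\<^sub>1' * (v * s))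
      + (d\<^sub>1' * (s * p) + d\<^sub>2' * (s * q) + f * (s * s))" (is "?l = ?r")
proof -
  have "?l - ?r = (c\<^sub>1 - c\<^sub>1') * (p * v) + (d\<^sub>1 - d\<^sub>1') * (p * s) + (e\<^sub>1 - e\<^sub>1') * (s * v)
      + ((c\<^sub>2 - c\<^sub>2') * (q * u) + (d\<^sub>2 - d\<^sub>2') * (q * s) + (e\<^sub>2 - e\<^sub>2') * (s * u))"
    by (simp add: algebra_simps)
  also have "\<dots> = 0"
    unfolding assms by (simp add: algebra_simps)
  finally show ?thesis
    by (rule iffD2[OF eq_iff_diff_eq_0])
qed

lemma conn_commute: "(\<Sum>k\<in>UNIV. conn\<^sub>1 i k * conn\<^sub>2 k j) = (\<Sum>k\<in>UNIV. conn\<^sub>2 i k * conn\<^sub>1 k j)"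
proof -
  let ?s = "y\<^sub>1 + y\<^sub>2 - 1"
  have triangle: "1 / y\<^sub>1 * (1 / (y\<^sub>2 - 1)) = 1 / y\<^sub>1 * (1 / ?s) + 1 / ?s * (1 / (y\<^sub>2 - 1))"
    "1 / (y\<^sub>1 - 1) * (1 / y\<^sub>2) = 1 / (y\<^sub>1 - 1) * (1 / ?s) + 1 / ?s * (1 / y\<^sub>2)"
    by (rule inverse_triangle[OF _ y_nz(1,6,8)] inverse_triangle[OF _ y_nz(5,2,8)]; simp)+
  have comm: "cst (A $ i $ j) - cst (B $ i $ j) = - (cst (C $ i $ j) - cst (D $ i $ j))"
    if "A - B = D - C" for A B C D :: "K ^ 4 ^ 4"
    using arg_cong[OF that, of "\<lambda>X. cst (X $ i $ j)"] by (simp add: cst_diff)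
  show ?thesis
    unfolding conn\<^sub>1_def conn\<^sub>2_def sum_trilinear_product cst_matrix_product Xi_commutators(1,2)
    by (rule residue_cancellation[OF triangle refl _ _ refl])
      (rule comm Xi_commutators)+
qed

lemma Xi_wedge_square: "wedge_mat Xi_hat Xi_hat = 0"
proof -
  have "Xi_hat $ i $ k \<and>\<^sub>f Xi_hat $ k $ j = monoform {2, 3} (conn\<^sub>1 i k * conn\<^sub>2 k j - conn\<^sub>2 i k * conn\<^sub>1 k j)"
    for i j k
    by (simp add: Xi_hat_entry form_simps monoform_diff monoform_minus)
  then have "wedge_mat Xi_hat Xi_hat $ i $ j = 0" for i j
    by (simp add: wedge_mat_def monoform_sum sum_subtractf conn_commute)
  then show ?thesis
    by (simp add: vec_eq_iff)
qed

section \<open>Covariant derivatives of the frame\<close>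

abbreviation "f\<^sub>1 \<equiv> F\<^sub>1 pr_x\<^sub>1 pr_x\<^sub>2"
abbreviation "f\<^sub>2 \<equiv> F\<^sub>2 pr_x\<^sub>1 pr_x\<^sub>2"
abbreviation "f\<^sub>3 \<equiv> F\<^sub>3 pr_x\<^sub>1 pr_x\<^sub>2"
abbreviation "f\<^sub>4 \<equiv> F\<^sub>4 pr_x\<^sub>1 pr_x\<^sub>2"
abbreviation "n\<^sub>2\<^sub>1 \<equiv> N\<^sub>2\<^sub>1 pr_x\<^sub>1 pr_x\<^sub>2"
abbreviation "n\<^sub>3\<^sub>2 \<equiv> N\<^sub>3\<^sub>2 pr_x\<^sub>1 pr_x\<^sub>2"
abbreviation "n\<^sub>4\<^sub>1 \<equiv> N\<^sub>4\<^sub>1 pr_x\<^sub>1 pr_x\<^sub>2"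
abbreviation "n\<^sub>4\<^sub>2 \<equiv> N\<^sub>4\<^sub>2 pr_x\<^sub>1 pr_x\<^sub>2"
abbreviation "h\<^sub>0 \<equiv> H\<^sub>0 pr_x\<^sub>1 pr_x\<^sub>2"
abbreviation "\<delta> \<equiv> 1 - y\<^sub>1 - y\<^sub>2"

definition frame_coeff :: "ratfun ^ 4" where
  "frame_coeff = vector [f\<^sub>1, f\<^sub>2, f\<^sub>3, \<delta> * f\<^sub>4]"

text \<open>
  The covariant derivatives of the frame along \<open>y\<^sub>1\<close> and \<open>y\<^sub>2\<close> are found from those along \<open>x\<^sub>1\<close> and
  \<open>x\<^sub>2\<close> by the chain rule: \<open>\<partial>/\<partial>y\<^sub>1\<close> is \<open>(1 - y\<^sub>2) \<partial>/\<partial>x\<^sub>1 - y\<^sub>2 \<partial>/\<partial>x\<^sub>2\<close> and \<open>\<partial>/\<partial>y\<^sub>2\<close> is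
  \<open>(1 - y\<^sub>1) \<partial>/\<partial>x\<^sub>2 - y\<^sub>1 \<partial>/\<partial>x\<^sub>1\<close>. The summand \<open>- f\<^sub>4\<close> in the last entries is the derivative of the
  factor \<open>\<delta>\<close>.
\<close>

definition deriv\<^sub>1 :: "ratfun ^ 4" where
  "deriv\<^sub>1 = vector
    [- \<mu>\<^sub>4 * (1 / y\<^sub>1) * f\<^sub>2 - (- \<mu>\<^sub>4 * (1 / (1 - y\<^sub>1))) * f\<^sub>3,
     (1 - y\<^sub>2) * n\<^sub>2\<^sub>1 - y\<^sub>2 * (pr_x\<^sub>1 * h\<^sub>0),
     (1 - y\<^sub>2) * (pr_x\<^sub>2 * h\<^sub>0) - y\<^sub>2 * n\<^sub>3\<^sub>2,
     \<delta> * ((1 - y\<^sub>2) * n\<^sub>4\<^sub>1 - y\<^sub>2 * n\<^sub>4\<^sub>2) - f\<^sub>4]"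

definition deriv\<^sub>2 :: "ratfun ^ 4" where
  "deriv\<^sub>2 = vector
    [- \<mu>\<^sub>4 * (1 / y\<^sub>2) * f\<^sub>3 - (- \<mu>\<^sub>4 * (1 / (1 - y\<^sub>2))) * f\<^sub>2,
     (1 - y\<^sub>1) * (pr_x\<^sub>1 * h\<^sub>0) - y\<^sub>1 * n\<^sub>2\<^sub>1,
     (1 - y\<^sub>1) * n\<^sub>3\<^sub>2 - y\<^sub>1 * (pr_x\<^sub>2 * h\<^sub>0),
     \<delta> * ((1 - y\<^sub>1) * n\<^sub>4\<^sub>2 - y\<^sub>1 * n\<^sub>4\<^sub>1) - f\<^sub>4]"

lemma phi_hat_eq: "phi_hat $ i = monoform {0, Suc 0} (frame_coeff $ i)"
proof -
  have ds: "ds\<^sub>1\<^sub>2 = monoform {0, Suc 0} 1"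
    by (simp add: ds\<^sub>1\<^sub>2_def ds\<^sub>1_def ds\<^sub>2_def dz_eq_monoform wedge_monoform)
  have "phi $ 1 = monoform {0, Suc 0} (F\<^sub>1 x\<^sub>1 x\<^sub>2)" "phi $ 2 = monoform {0, Suc 0} (F\<^sub>2 x\<^sub>1 x\<^sub>2)"
    "phi $ 3 = monoform {0, Suc 0} (F\<^sub>3 x\<^sub>1 x\<^sub>2)" "phi $ 4 = monoform {0, Suc 0} (F\<^sub>4 x\<^sub>1 x\<^sub>2)"
    by (simp_all add: phi_def vector_4 ds scal_monoform coeff_defs lin_x)
  then have "phi_tilde $ 1 = monoform {0, Suc 0} f\<^sub>1" "phi_tilde $ 2 = monoform {0, Suc 0} f\<^sub>2"
    "phi_tilde $ 3 = monoform {0, Suc 0} f\<^sub>3" "phi_tilde $ 4 = monoform {0, Suc 0} f\<^sub>4"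
    by (simp_all add: phi_tilde_def pr_form_simps has_pullback_coeffs[THEN pr_fun_eqI])
  then show ?thesis
    using exhaust_4[of i] by (auto simp: phi_hat_def frame_coeff_def vector_4 scal_monoform)
qed

lemma phi_hat_in_bundle: "phi_hat $ i \<in> pr_module (Omega 2 0)"
proof -
  have "monoform {0, Suc 0} g \<in> pr_module (Omega 2 0)" if "f \<in> O_XX" "has_pullback f g" for f g
  proof -
    have "monoform {0, Suc 0} f \<in> Omega 2 0"
      unfolding Omega_def using that(1) by (intro forms_over_monoform O_XX_intros) auto
    then show ?thesis
      using pr_form_in_pr_module that(2) by (fastforce simp: pr_form_simps dest: pr_fun_eqI)
  qed
  then have "monoform {0, Suc 0} f\<^sub>1 \<in> pr_module (Omega 2 0)" "monoform {0, Suc 0} f\<^sub>2 \<in> pr_module (Omega 2 0)"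
    "monoform {0, Suc 0} f\<^sub>3 \<in> pr_module (Omega 2 0)" "monoform {0, Suc 0} f\<^sub>4 \<in> pr_module (Omega 2 0)"
    using coeffs_in_O_XX has_pullback_coeffs by blast+
  moreover have "\<delta> \<in> O_Y"
    by (intro O_Y_intros)
  ultimately show ?thesis
    using exhaust_4[of i] pr_module_scal[of \<delta> "monoform {0, Suc 0} f\<^sub>4" "Omega 2 0"]
    by (auto simp: phi_hat_eq frame_coeff_def vector_4 scal_monoform)
qed

lemma nabla_Y_monoform:
  "nabla_Y (monoform {0, Suc 0} u) =
     monoform {0, Suc 0, 2}
       (pd 2 u + (1 - y\<^sub>2) * (- \<mu>\<^sub>4 * s\<^sub>1 / lin pr_x\<^sub>1 pr_x\<^sub>2) * u - y\<^sub>2 * (- \<mu>\<^sub>4 * s\<^sub>2 / lin pr_x\<^sub>1 pr_x\<^sub>2) * u)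
   + monoform {0, Suc 0, 3}
       (pd 3 u + (1 - y\<^sub>1) * (- \<mu>\<^sub>4 * s\<^sub>2 / lin pr_x\<^sub>1 pr_x\<^sub>2) * u - y\<^sub>1 * (- \<mu>\<^sub>4 * s\<^sub>1 / lin pr_x\<^sub>1 pr_x\<^sub>2) * u)"
proof -
  have eq: "omega_X = monoform {2} (- (\<mu>\<^sub>4 * s\<^sub>1 / Lsx)) + monoform {3} (- (\<mu>\<^sub>4 * s\<^sub>2 / Lsx))"
    by (simp add: omega_X_def dx\<^sub>1_def dx\<^sub>2_def dz_eq_monoform scal_monoform monoform_minus)
  have pr: "pr_fun (- (\<mu>\<^sub>4 * s\<^sub>1 / Lsx)) = - (\<mu>\<^sub>4 * s\<^sub>1 / lin pr_x\<^sub>1 pr_x\<^sub>2)"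
    "pr_fun (- (\<mu>\<^sub>4 * s\<^sub>2 / Lsx)) = - (\<mu>\<^sub>4 * s\<^sub>2 / lin pr_x\<^sub>1 pr_x\<^sub>2)"
    unfolding lin_x[symmetric]
    by (rule pr_fun_eqI, intro has_pullback_intros has_pullback_lin lin_y_nz)+
  have "pr_form omega_X = pr_form (monoform {2} (- (\<mu>\<^sub>4 * s\<^sub>1 / Lsx))) + pr_form (monoform {3} (- (\<mu>\<^sub>4 * s\<^sub>2 / Lsx)))"
    unfolding eq by (rule pr_form_add_disjoint) (auto simp: monoform_def)
  then show ?thesis
    by (simp add: nabla_Y_def d_y_def ext_d_monoform pr_form_simps pr form_simps)
      (auto simp: monoform_def fun_eq_iff algebra_simps)
qed

lemma pd_lin: "pd 2 (lin pr_x\<^sub>1 pr_x\<^sub>2) = - s\<^sub>1 * (1 - y\<^sub>2) + s\<^sub>2 * y\<^sub>2"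
  "pd 3 (lin pr_x\<^sub>1 pr_x\<^sub>2) = s\<^sub>1 * y\<^sub>1 - s\<^sub>2 * (1 - y\<^sub>1)"
  by (simp_all add: lin_def pd_simps)

lemma pd_Qs_y: "pd 2 Qs = 0" "pd 3 Qs = 0"
  by (simp_all add: Qs_def pd_simps)

lemma frame_derivative_y\<^sub>1:
  "pd 2 (frame_coeff $ i) + (1 - y\<^sub>2) * (- \<mu>\<^sub>4 * s\<^sub>1 / lin pr_x\<^sub>1 pr_x\<^sub>2) * frame_coeff $ i
    - y\<^sub>2 * (- \<mu>\<^sub>4 * s\<^sub>2 / lin pr_x\<^sub>1 pr_x\<^sub>2) * frame_coeff $ i = deriv\<^sub>1 $ i"
proof -
  note nz = s\<^sub>1_nz s\<^sub>2_nz Qs_nz y_nz y_nz' lin_y_nz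
  consider "i = 1" | "i = 2" | "i = 3" | "i = 4"
    using exhaust_4[of i] by blast
  then show ?thesis
  proof cases
    case 1
    show ?thesis
      unfolding 1 frame_coeff_def deriv\<^sub>1_def vector_4 coeff_defs
      using nz by (simp add: pd_simps divide_simps)
  next
    case 2
    show ?thesis
      unfolding 2 frame_coeff_def deriv\<^sub>1_def vector_4 coeff_defs
      using nz by (simp add: pd_simps pd_lin pd_Qs_y divide_simps) (simp add: lin_def algebra_simps)
  next
    case 3
    show ?thesis
      unfolding 3 frame_coeff_def deriv\<^sub>1_def vector_4 coeff_defs
      using nz by (simp add: pd_simps pd_lin pd_Qs_y divide_simps) (simp add: lin_def algebra_simps)
  next
    case 4
    show ?thesis
      unfolding 4 frame_coeff_def deriv\<^sub>1_def vector_4 coeff_defs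
      using nz by (simp add: pd_simps pd_lin pd_Qs_y divide_simps) (simp add: algebra_simps)
  qed
qed

lemma frame_derivative_y\<^sub>2:
  "pd 3 (frame_coeff $ i) + (1 - y\<^sub>1) * (- \<mu>\<^sub>4 * s\<^sub>2 / lin pr_x\<^sub>1 pr_x\<^sub>2) * frame_coeff $ i
    - y\<^sub>1 * (- \<mu>\<^sub>4 * s\<^sub>1 / lin pr_x\<^sub>1 pr_x\<^sub>2) * frame_coeff $ i = deriv\<^sub>2 $ i"
proof -
  note nz = s\<^sub>1_nz s\<^sub>2_nz Qs_nz y_nz y_nz' lin_y_nz
  consider "i = 1" | "i = 2" | "i = 3" | "i = 4"
    using exhaust_4[of i] by blast
  then show ?thesis
  proof cases
    case 1
    show ?thesis
      unfolding 1 frame_coeff_def deriv\<^sub>2_def vector_4 coeff_defs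
      using nz by (simp add: pd_simps divide_simps)
  next
    case 2
    show ?thesis
      unfolding 2 frame_coeff_def deriv\<^sub>2_def vector_4 coeff_defs
      using nz by (simp add: pd_simps pd_lin pd_Qs_y divide_simps) (simp add: lin_def algebra_simps)
  next
    case 3
    show ?thesis
      unfolding 3 frame_coeff_def deriv\<^sub>2_def vector_4 coeff_defs
      using nz by (simp add: pd_simps pd_lin pd_Qs_y divide_simps) (simp add: lin_def algebra_simps)
  next
    case 4
    show ?thesis
      unfolding 4 frame_coeff_def deriv\<^sub>2_def vector_4 coeff_defs
      using nz by (simp add: pd_simps pd_lin pd_Qs_y divide_simps) (simp add: algebra_simps)
  qed
qed

lemma nabla_Y_phi_hat:
  "nabla_Y (phi_hat $ i) = monoform {0, Suc 0, 2} (deriv\<^sub>1 $ i) + monoform {0, Suc 0, 3} (deriv\<^sub>2 $ i)"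
  unfolding phi_hat_eq nabla_Y_monoform frame_derivative_y\<^sub>1 frame_derivative_y\<^sub>2 ..

section \<open>Reduction modulo exact forms\<close>

lemma lam\<^sub>3_nz': "\<mu>\<^sub>3 \<noteq> 0"
  using lam\<^sub>3_nz by simp

abbreviation (input) "r\<^sub>a \<equiv> rel_a pr_x\<^sub>1 pr_x\<^sub>2"
abbreviation (input) "r\<^sub>b \<equiv> rel_b pr_x\<^sub>1 pr_x\<^sub>2"
abbreviation (input) "r\<^sub>c \<equiv> rel_c pr_x\<^sub>1 pr_x\<^sub>2"
abbreviation (input) "r\<^sub>d \<equiv> rel_d pr_x\<^sub>1 pr_x\<^sub>2"
abbreviation (input) "r\<^sub>e \<equiv> rel_e pr_x\<^sub>1 pr_x\<^sub>2"
abbreviation (input) "r\<^sub>g \<equiv> rel_g pr_x\<^sub>1 pr_x\<^sub>2"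
abbreviation (input) "r\<^sub>h \<equiv> rel_h pr_x\<^sub>1 pr_x\<^sub>2"

lemmas entry_simps = conj_I_entry Xi\<^sub>1_def Xi\<^sub>2_def Xi\<^sub>3_def diag4_def vector_4
  lam\<^sub>1\<^sub>2\<^sub>3_def lam\<^sub>1\<^sub>3\<^sub>4'_def lam\<^sub>2\<^sub>3\<^sub>4'_def cst_add cst_minus cst_diff cst_mult cst_divide cst_numeral

text \<open>
  The derivative of \<open>\<phi>\<^sub>1\<close> along \<open>x\<^sub>k\<close> is the multiple \<open>- \<lambda>\<^sub>4 / x\<^sub>k\<close> of \<open>\<phi>\<^sub>2\<close> for \<open>k = 1\<close> and of \<open>\<phi>\<^sub>3\<close> for
  \<open>k = 2\<close>. This is an identity of forms, without integration by parts.
\<close>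

lemma reduction_1:
  "deriv\<^sub>1 $ 1 - (\<Sum>j\<in>UNIV. conn\<^sub>1 1 j * frame_coeff $ j) = 0"
  "deriv\<^sub>2 $ 1 - (\<Sum>j\<in>UNIV. conn\<^sub>2 1 j * frame_coeff $ j) = 0"
  unfolding sum_4 conn\<^sub>1_def conn\<^sub>2_def deriv\<^sub>1_def deriv\<^sub>2_def frame_coeff_def
  using y_nz y_nz' by (simp_all add: entry_simps divide_simps) (simp_all add: algebra_simps)

text \<open>
  The coefficients of \<open>rel_a\<close> come from \<open>dx\<^sub>1 / x\<^sub>1 = dy\<^sub>1 / y\<^sub>1 + dy\<^sub>2 / (y\<^sub>2 - 1)\<close>. In
  \<open>(rel_c + rel_d + rel_e) / 2\<close> the auxiliary \<open>G\<^sub>1\<close> and \<open>G\<^sub>2\<close> cancel, and it is the reduction of the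
  mixed derivative \<open>x\<^sub>1 x\<^sub>2 H\<^sub>0\<close>, which enters with \<open>dx\<^sub>2 / x\<^sub>2 = dy\<^sub>1 / (y\<^sub>1 - 1) + dy\<^sub>2 / y\<^sub>2\<close>. For \<open>\<phi>\<^sub>3\<close> the
  roles of \<open>x\<^sub>1\<close> and \<open>x\<^sub>2\<close> are exchanged.
\<close>

lemma reduction_2_y\<^sub>1:
  "deriv\<^sub>1 $ 2 - (\<Sum>j\<in>UNIV. conn\<^sub>1 2 j * frame_coeff $ j)
    = 1 / y\<^sub>1 * r\<^sub>a + 1 / (y\<^sub>1 - 1) * (cst (1 / 2) * (r\<^sub>c + r\<^sub>d + r\<^sub>e))"
  unfolding sum_4 conn\<^sub>1_def deriv\<^sub>1_def frame_coeff_def rel_defs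
  using y_nz y_nz' lam\<^sub>3_nz'
  by (simp add: entry_simps divide_simps numeral_neq_zero) (simp add: algebra_simps)

lemma reduction_2_y\<^sub>2:
  "deriv\<^sub>2 $ 2 - (\<Sum>j\<in>UNIV. conn\<^sub>2 2 j * frame_coeff $ j)
    = 1 / (y\<^sub>2 - 1) * r\<^sub>a + 1 / y\<^sub>2 * (cst (1 / 2) * (r\<^sub>c + r\<^sub>d + r\<^sub>e))"
  unfolding sum_4 conn\<^sub>2_def deriv\<^sub>2_def frame_coeff_def rel_defs
  using y_nz y_nz' lam\<^sub>3_nz'
  by (simp add: entry_simps divide_simps numeral_neq_zero) (simp add: algebra_simps)

lemma reduction_3_y\<^sub>1:
  "deriv\<^sub>1 $ 3 - (\<Sum>j\<in>UNIV. conn\<^sub>1 3 j * frame_coeff $ j)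
    = 1 / (y\<^sub>1 - 1) * r\<^sub>b + 1 / y\<^sub>1 * (cst (1 / 2) * (r\<^sub>c + r\<^sub>d + r\<^sub>e))"
  unfolding sum_4 conn\<^sub>1_def deriv\<^sub>1_def frame_coeff_def rel_defs
  using y_nz y_nz' lam\<^sub>3_nz'
  by (simp add: entry_simps divide_simps numeral_neq_zero) (simp add: algebra_simps)

lemma reduction_3_y\<^sub>2:
  "deriv\<^sub>2 $ 3 - (\<Sum>j\<in>UNIV. conn\<^sub>2 3 j * frame_coeff $ j)
    = 1 / y\<^sub>2 * r\<^sub>b + 1 / (y\<^sub>2 - 1) * (cst (1 / 2) * (r\<^sub>c + r\<^sub>d + r\<^sub>e))"
  unfolding sum_4 conn\<^sub>2_def deriv\<^sub>2_def frame_coeff_def rel_defs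
  using y_nz y_nz' lam\<^sub>3_nz'
  by (simp add: entry_simps divide_simps numeral_neq_zero) (simp add: algebra_simps)

text \<open>
  Everything needed for the last row, sorted by the functions that occur: \<open>a\<close> and \<open>b\<close> multiply the
  linear system for the derivatives of \<open>\<phi>\<^sub>4\<close>, while \<open>p\<close>, \<open>q\<close> and \<open>r\<close> multiply the reductions of \<open>G\<^sub>1\<close>,
  \<open>G\<^sub>2\<close> and \<open>H\<^sub>0\<close>. The proof for either direction then only compares nine coefficients.
\<close>

lemma relation_combination:
  "a * rel_g x x' + b * rel_h x x' + p * (rel_d x x' - rel_c x x' - rel_e x x')
      + q * (rel_c x x' - rel_d x x' - rel_e x x') + r * (rel_c x x' + rel_d x x' + rel_e x x') =
    (a * (1 - x - x') - 2 * b * x) * N\<^sub>4\<^sub>1 x x' + (b * (1 - x - x') - 2 * a * x') * N\<^sub>4\<^sub>2 x x'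
    + (a * (\<mu>\<^sub>1 + \<mu>\<^sub>3 + \<mu>\<^sub>4) + 2 * p * \<mu>\<^sub>3 * x) * G\<^sub>1 x x'
    + (b * (\<mu>\<^sub>2 + \<mu>\<^sub>3 + \<mu>\<^sub>4) + 2 * q * \<mu>\<^sub>3 * x') * G\<^sub>2 x x'
    + (2 * r * x * x' - a * x' - b * x) * H\<^sub>0 x x'
    + (r - p - q) * (\<mu>\<^sub>1 + \<mu>\<^sub>2 + \<mu>\<^sub>3) * F\<^sub>1 x x'
    + (p * (\<mu>\<^sub>4 + \<mu>\<^sub>2) + q * (\<mu>\<^sub>4 - \<mu>\<^sub>2) + r * (\<mu>\<^sub>2 - \<mu>\<^sub>4)) * F\<^sub>2 x x'
    + (p * (\<mu>\<^sub>4 - \<mu>\<^sub>1) + q * (\<mu>\<^sub>4 + \<mu>\<^sub>1) + r * (\<mu>\<^sub>1 - \<mu>\<^sub>4)) * F\<^sub>3 x x'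
    + (\<mu>\<^sub>3 * (r * (1 - x - x') - p * (1 + x - x') - q * (1 - x + x')) - (a + b) * ((\<mu>\<^sub>1 + \<mu>\<^sub>2 + \<mu>\<^sub>3) + 1)) * F\<^sub>4 x x'"
  unfolding rel_defs by (simp add: algebra_simps)

text \<open>
  The multipliers \<open>1 - y\<^sub>2\<close> and \<open>y\<^sub>2\<close> of \<open>rel_g\<close> and \<open>rel_h\<close> are those for which the derivatives of \<open>\<phi>\<^sub>4\<close>
  combine to \<open>\<delta>\<close> times the derivative along \<open>y\<^sub>1\<close>. The other multipliers are then forced: they
  eliminate \<open>G\<^sub>1\<close>, \<open>G\<^sub>2\<close> and \<open>H\<^sub>0\<close>, and what remains is the last row of the connection matrix.
\<close>

lemma reduction_4_y\<^sub>1: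
  "deriv\<^sub>1 $ 4 - (\<Sum>j\<in>UNIV. conn\<^sub>1 4 j * frame_coeff $ j)
    = (1 - y\<^sub>2) * r\<^sub>g + (y\<^sub>2) * r\<^sub>h + - (1 / y\<^sub>1 * cst ((lam\<^sub>1 + lam\<^sub>3 + lam\<^sub>4) / (2 * lam\<^sub>3))) * (r\<^sub>d - r\<^sub>c - r\<^sub>e)
      + 1 / (y\<^sub>1 - 1) * cst ((lam\<^sub>2 + lam\<^sub>3 + lam\<^sub>4) / (2 * lam\<^sub>3)) * (r\<^sub>c - r\<^sub>d - r\<^sub>e) + (1 / y\<^sub>1 - 1 / (y\<^sub>1 - 1)) * cst (1 / 2) * (r\<^sub>c + r\<^sub>d + r\<^sub>e)"
proof -
  let ?a = "1 - y\<^sub>2" and ?b = "y\<^sub>2" and ?p = "- (1 / y\<^sub>1 * cst ((lam\<^sub>1 + lam\<^sub>3 + lam\<^sub>4) / (2 * lam\<^sub>3)))" and ?q = "1 / (y\<^sub>1 - 1) * cst ((lam\<^sub>2 + lam\<^sub>3 + lam\<^sub>4) / (2 * lam\<^sub>3))" and ?r = "(1 / y\<^sub>1 - 1 / (y\<^sub>1 - 1)) * cst (1 / 2)"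
  let ?x = pr_x\<^sub>1 and ?x' = pr_x\<^sub>2
  note nz = y_nz y_nz' lam\<^sub>3_nz'
  have n\<^sub>4\<^sub>1: "?a * (1 - ?x - ?x') - 2 * ?b * ?x = \<delta> * (1 - y\<^sub>2)"
    and n\<^sub>4\<^sub>2: "?b * (1 - ?x - ?x') - 2 * ?a * ?x' = - (\<delta> * y\<^sub>2)"
    by (simp_all add: algebra_simps)
  have g\<^sub>1: "?a * (\<mu>\<^sub>1 + \<mu>\<^sub>3 + \<mu>\<^sub>4) + 2 * ?p * \<mu>\<^sub>3 * ?x = 0"
    using nz by (simp add: entry_simps divide_simps numeral_neq_zero;
      simp add: algebra_simps numeral_neq_zero_K)
  have g\<^sub>2: "?b * (\<mu>\<^sub>2 + \<mu>\<^sub>3 + \<mu>\<^sub>4) + 2 * ?q * \<mu>\<^sub>3 * ?x' = 0"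
    using nz by (simp add: entry_simps divide_simps numeral_neq_zero;
      simp add: algebra_simps numeral_neq_zero_K)
  have h: "2 * ?r * ?x * ?x' - ?a * ?x' - ?b * ?x = 0"
    using nz by (simp add: entry_simps divide_simps numeral_neq_zero;
      simp add: algebra_simps numeral_neq_zero_K)
  have c\<^sub>1: "(?r - ?p - ?q) * (\<mu>\<^sub>1 + \<mu>\<^sub>2 + \<mu>\<^sub>3) = - conn\<^sub>1 4 1"
    unfolding conn\<^sub>1_def
    using nz by (simp add: entry_simps divide_simps numeral_neq_zero;
      simp add: algebra_simps numeral_neq_zero_K)
  have c\<^sub>2: "?p * (\<mu>\<^sub>4 + \<mu>\<^sub>2) + ?q * (\<mu>\<^sub>4 - \<mu>\<^sub>2) + ?r * (\<mu>\<^sub>2 - \<mu>\<^sub>4) = - conn\<^sub>1 4 2"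
    unfolding conn\<^sub>1_def
    using nz by (simp add: entry_simps divide_simps numeral_neq_zero;
      simp add: algebra_simps numeral_neq_zero_K)
  have c\<^sub>3: "?p * (\<mu>\<^sub>4 - \<mu>\<^sub>1) + ?q * (\<mu>\<^sub>4 + \<mu>\<^sub>1) + ?r * (\<mu>\<^sub>1 - \<mu>\<^sub>4) = - conn\<^sub>1 4 3"
    unfolding conn\<^sub>1_def
    using nz by (simp add: entry_simps divide_simps numeral_neq_zero;
      simp add: algebra_simps numeral_neq_zero_K)
  have c\<^sub>4: "\<mu>\<^sub>3 * (?r * (1 - ?x - ?x') - ?p * (1 + ?x - ?x') - ?q * (1 - ?x + ?x'))
      - (?a + ?b) * ((\<mu>\<^sub>1 + \<mu>\<^sub>2 + \<mu>\<^sub>3) + 1) = - 1 - conn\<^sub>1 4 4 * \<delta>"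
    unfolding conn\<^sub>1_def
    using nz by (simp add: entry_simps divide_simps numeral_neq_zero;
      simp add: algebra_simps numeral_neq_zero_K)
  show ?thesis
    unfolding relation_combination n\<^sub>4\<^sub>1 n\<^sub>4\<^sub>2 g\<^sub>1 g\<^sub>2 h c\<^sub>1 c\<^sub>2 c\<^sub>3 c\<^sub>4 deriv\<^sub>1_def frame_coeff_def sum_4 vector_4
    by (simp add: algebra_simps)
qed

lemma reduction_4_y\<^sub>2:
  "deriv\<^sub>2 $ 4 - (\<Sum>j\<in>UNIV. conn\<^sub>2 4 j * frame_coeff $ j)
    = (y\<^sub>1) * r\<^sub>g + (1 - y\<^sub>1) * r\<^sub>h + 1 / (y\<^sub>2 - 1) * cst ((lam\<^sub>1 + lam\<^sub>3 + lam\<^sub>4) / (2 * lam\<^sub>3)) * (r\<^sub>d - r\<^sub>c - r\<^sub>e)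
      + - (1 / y\<^sub>2 * cst ((lam\<^sub>2 + lam\<^sub>3 + lam\<^sub>4) / (2 * lam\<^sub>3))) * (r\<^sub>c - r\<^sub>d - r\<^sub>e) + (1 / y\<^sub>2 - 1 / (y\<^sub>2 - 1)) * cst (1 / 2) * (r\<^sub>c + r\<^sub>d + r\<^sub>e)"
proof -
  let ?a = "y\<^sub>1" and ?b = "1 - y\<^sub>1" and ?p = "1 / (y\<^sub>2 - 1) * cst ((lam\<^sub>1 + lam\<^sub>3 + lam\<^sub>4) / (2 * lam\<^sub>3))" and ?q = "- (1 / y\<^sub>2 * cst ((lam\<^sub>2 + lam\<^sub>3 + lam\<^sub>4) / (2 * lam\<^sub>3)))" and ?r = "(1 / y\<^sub>2 - 1 / (y\<^sub>2 - 1)) * cst (1 / 2)"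
  let ?x = pr_x\<^sub>1 and ?x' = pr_x\<^sub>2
  note nz = y_nz y_nz' lam\<^sub>3_nz'
  have n\<^sub>4\<^sub>1: "?a * (1 - ?x - ?x') - 2 * ?b * ?x = - (\<delta> * y\<^sub>1)"
    and n\<^sub>4\<^sub>2: "?b * (1 - ?x - ?x') - 2 * ?a * ?x' = \<delta> * (1 - y\<^sub>1)"
    by (simp_all add: algebra_simps)
  have g\<^sub>1: "?a * (\<mu>\<^sub>1 + \<mu>\<^sub>3 + \<mu>\<^sub>4) + 2 * ?p * \<mu>\<^sub>3 * ?x = 0"
    using nz by (simp add: entry_simps divide_simps numeral_neq_zero;
      simp add: algebra_simps numeral_neq_zero_K)
  have g\<^sub>2: "?b * (\<mu>\<^sub>2 + \<mu>\<^sub>3 + \<mu>\<^sub>4) + 2 * ?q * \<mu>\<^sub>3 * ?x' = 0"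
    using nz by (simp add: entry_simps divide_simps numeral_neq_zero;
      simp add: algebra_simps numeral_neq_zero_K)
  have h: "2 * ?r * ?x * ?x' - ?a * ?x' - ?b * ?x = 0"
    using nz by (simp add: entry_simps divide_simps numeral_neq_zero;
      simp add: algebra_simps numeral_neq_zero_K)
  have c\<^sub>1: "(?r - ?p - ?q) * (\<mu>\<^sub>1 + \<mu>\<^sub>2 + \<mu>\<^sub>3) = - conn\<^sub>2 4 1"
    unfolding conn\<^sub>2_def
    using nz by (simp add: entry_simps divide_simps numeral_neq_zero;
      simp add: algebra_simps numeral_neq_zero_K)
  have c\<^sub>2: "?p * (\<mu>\<^sub>4 + \<mu>\<^sub>2) + ?q * (\<mu>\<^sub>4 - \<mu>\<^sub>2) + ?r * (\<mu>\<^sub>2 - \<mu>\<^sub>4) = - conn\<^sub>2 4 2"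
    unfolding conn\<^sub>2_def
    using nz by (simp add: entry_simps divide_simps numeral_neq_zero;
      simp add: algebra_simps numeral_neq_zero_K)
  have c\<^sub>3: "?p * (\<mu>\<^sub>4 - \<mu>\<^sub>1) + ?q * (\<mu>\<^sub>4 + \<mu>\<^sub>1) + ?r * (\<mu>\<^sub>1 - \<mu>\<^sub>4) = - conn\<^sub>2 4 3"
    unfolding conn\<^sub>2_def
    using nz by (simp add: entry_simps divide_simps numeral_neq_zero;
      simp add: algebra_simps numeral_neq_zero_K)
  have c\<^sub>4: "\<mu>\<^sub>3 * (?r * (1 - ?x - ?x') - ?p * (1 + ?x - ?x') - ?q * (1 - ?x + ?x'))
      - (?a + ?b) * ((\<mu>\<^sub>1 + \<mu>\<^sub>2 + \<mu>\<^sub>3) + 1) = - 1 - conn\<^sub>2 4 4 * \<delta>"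
    unfolding conn\<^sub>2_def
    using nz by (simp add: entry_simps divide_simps numeral_neq_zero;
      simp add: algebra_simps numeral_neq_zero_K)
  show ?thesis
    unfolding relation_combination n\<^sub>4\<^sub>1 n\<^sub>4\<^sub>2 g\<^sub>1 g\<^sub>2 h c\<^sub>1 c\<^sub>2 c\<^sub>3 c\<^sub>4 deriv\<^sub>2_def frame_coeff_def sum_4 vector_4
    by (simp add: algebra_simps)
qed

lemma reduced_derivative_exact:
  "deriv\<^sub>1 $ i - (\<Sum>j\<in>UNIV. conn\<^sub>1 i j * frame_coeff $ j) \<in> exact 2"
  "deriv\<^sub>2 $ i - (\<Sum>j\<in>UNIV. conn\<^sub>2 i j * frame_coeff $ j) \<in> exact 3"
proof -
  note closed = coeff_module_add coeff_module_diff coeff_module_mult rels_exact O_Y_intros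
  consider "i = 1" | "i = 2" | "i = 3" | "i = 4"
    using exhaust_4[of i] by blast
  then have "deriv\<^sub>1 $ i - (\<Sum>j\<in>UNIV. conn\<^sub>1 i j * frame_coeff $ j) \<in> exact 2
    \<and> deriv\<^sub>2 $ i - (\<Sum>j\<in>UNIV. conn\<^sub>2 i j * frame_coeff $ j) \<in> exact 3"
  proof cases
    case 1
    show ?thesis
      unfolding 1 reduction_1 by (simp only: coeff_module_0 simp_thms)
  next
    case 2
    show ?thesis
      unfolding 2 reduction_2_y\<^sub>1 reduction_2_y\<^sub>2 by (intro conjI closed) simp_all
  next
    case 3
    show ?thesis
      unfolding 3 reduction_3_y\<^sub>1 reduction_3_y\<^sub>2 by (intro conjI closed) simp_all
  next
    case 4
    show ?thesis
      unfolding 4 reduction_4_y\<^sub>1 reduction_4_y\<^sub>2 by (intro conjI closed) simp_all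
  qed
  then show "deriv\<^sub>1 $ i - (\<Sum>j\<in>UNIV. conn\<^sub>1 i j * frame_coeff $ j) \<in> exact 2"
    "deriv\<^sub>2 $ i - (\<Sum>j\<in>UNIV. conn\<^sub>2 i j * frame_coeff $ j) \<in> exact 3"
    by blast+
qed

lemma derivative_coefficients:
  "deriv\<^sub>1 $ i \<in> coeff_module (Omega 2 1) 2" "deriv\<^sub>2 $ i \<in> coeff_module (Omega 2 1) 3"
proof -
  have pulled: "g \<in> coeff_module (Omega 2 1) l" if "f \<in> O_XX" "has_pullback f g" "l \<in> {2, 3}" for f g l
  proof -
    have "monoform {0, Suc 0, m} f \<in> Omega 2 1" if "m \<in> {2, 3}" for m
      unfolding Omega_def using \<open>f \<in> O_XX\<close> that by (intro forms_over_monoform O_XX_intros) auto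
    then show ?thesis
      unfolding coeff_module_def using pr_module_dy[of f "Omega 2 1" g l] that by blast
  qed
  have gens: "f\<^sub>2 \<in> coeff_module (Omega 2 1) l" "f\<^sub>3 \<in> coeff_module (Omega 2 1) l" "f\<^sub>4 \<in> coeff_module (Omega 2 1) l"
    "n\<^sub>2\<^sub>1 \<in> coeff_module (Omega 2 1) l" "n\<^sub>3\<^sub>2 \<in> coeff_module (Omega 2 1) l" "n\<^sub>4\<^sub>1 \<in> coeff_module (Omega 2 1) l"
    "n\<^sub>4\<^sub>2 \<in> coeff_module (Omega 2 1) l" "h\<^sub>0 \<in> coeff_module (Omega 2 1) l" if "l \<in> {2, 3}" for l
    by (rule pulled[OF coeffs_in_O_XX(2) has_pullback_coeffs(2) that]
        pulled[OF coeffs_in_O_XX(3) has_pullback_coeffs(3) that]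
        pulled[OF coeffs_in_O_XX(4) has_pullback_coeffs(4) that]
        pulled[OF coeffs_in_O_XX(7) has_pullback_coeffs(7) that]
        pulled[OF coeffs_in_O_XX(8) has_pullback_coeffs(8) that]
        pulled[OF coeffs_in_O_XX(9) has_pullback_coeffs(9) that]
        pulled[OF coeffs_in_O_XX(10) has_pullback_coeffs(10) that]
        pulled[OF coeffs_in_O_XX(11) has_pullback_coeffs(11) that])+
  note closed = coeff_module_diff coeff_module_mult gens O_Y_intros
  consider "i = 1" | "i = 2" | "i = 3" | "i = 4"
    using exhaust_4[of i] by blast
  then have "deriv\<^sub>1 $ i \<in> coeff_module (Omega 2 1) 2 \<and> deriv\<^sub>2 $ i \<in> coeff_module (Omega 2 1) 3"
    by cases (simp_all only: deriv\<^sub>1_def deriv\<^sub>2_def vector_4, (intro conjI closed; simp)+)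
  then show "deriv\<^sub>1 $ i \<in> coeff_module (Omega 2 1) 2" "deriv\<^sub>2 $ i \<in> coeff_module (Omega 2 1) 3"
    by blast+
qed

section \<open>The connection matrix\<close>

lemma is_connection_matrix_Xi_hat: "is_connection_matrix phi_hat Xi_hat"
proof -
  have "Xi_hat $ i $ j \<in> forms_over O_Y 0 1" for i j
    unfolding Xi_hat_entry
    by (intro forms_over_add forms_over_monoform is_subring_O_Y conn_in_O_Y O_Y_intros) auto
  moreover have "nabla_Y (phi_hat $ i) \<in> pr_module (Omega 2 1)" for i
    using derivative_coefficients unfolding nabla_Y_phi_hat coeff_module_def
    by (blast intro: pr_module_add)
  moreover have "same_class (pr_module (nabla ` Omega 1 1)) (nabla_Y (phi_hat $ i))
      (\<Sum>j\<in>UNIV. Xi_hat $ i $ j \<and>\<^sub>f phi_hat $ j)" for i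
  proof -
    have "(\<Sum>j\<in>UNIV. Xi_hat $ i $ j \<and>\<^sub>f phi_hat $ j) =
        monoform {0, Suc 0, 2} (\<Sum>j\<in>UNIV. conn\<^sub>1 i j * frame_coeff $ j)
        + monoform {0, Suc 0, 3} (\<Sum>j\<in>UNIV. conn\<^sub>2 i j * frame_coeff $ j)"
      by (simp only: Xi_hat_entry phi_hat_eq wedge_one_form sum.distrib monoform_sum)
    then have "nabla_Y (phi_hat $ i) - (\<Sum>j\<in>UNIV. Xi_hat $ i $ j \<and>\<^sub>f phi_hat $ j) =
        monoform {0, Suc 0, 2} (deriv\<^sub>1 $ i - (\<Sum>j\<in>UNIV. conn\<^sub>1 i j * frame_coeff $ j))
        + monoform {0, Suc 0, 3} (deriv\<^sub>2 $ i - (\<Sum>j\<in>UNIV. conn\<^sub>2 i j * frame_coeff $ j))"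
      by (simp only: nabla_Y_phi_hat monoform_diff add_diff_add)
    moreover have "\<dots> \<in> pr_module (nabla ` Omega 1 1)"
      using reduced_derivative_exact unfolding coeff_module_def by (blast intro: pr_module_add)
    ultimately show ?thesis
      by (simp only: same_class_def)
  qed
  ultimately show ?thesis
    unfolding is_connection_matrix_def using phi_hat_in_bundle by blast
qed

theorem theorem5p1:
  shows "is_connection_matrix phi_hat Xi_hat
       \<and> (is_frame phi_hat \<longrightarrow> (\<forall>M. is_connection_matrix phi_hat M \<longrightarrow> M = Xi_hat))
       \<and> d_y_mat Xi_hat = wedge_mat Xi_hat Xi_hat
       \<and> wedge_mat Xi_hat Xi_hat = 0"
proof (intro conjI impI allI)
  show "is_connection_matrix phi_hat Xi_hat"
    by (rule is_connection_matrix_Xi_hat)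
  show "M = Xi_hat" if "is_frame phi_hat" "is_connection_matrix phi_hat M" for M
    using connection_matrix_unique[OF that(1) phi_hat_eq that(2) is_connection_matrix_Xi_hat] .
  show "wedge_mat Xi_hat Xi_hat = 0"
    by (rule Xi_wedge_square)
  show "d_y_mat Xi_hat = wedge_mat Xi_hat Xi_hat"
    by (simp only: Xi_closed Xi_wedge_square)
qed

end
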